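(* Let $(A,\ast,\circ)$ be a (finite-dimensional) pre-Poisson algebra, $(B=\oplus_{i\in\mathbb Z}B_i,\diamond,\omega)$ a quadratic $\mathbb Z$-graded perm algebra, and $(A\otimes B,\cdot,[-,-])$ the induced $\mathbb Z$-graded Poisson algebra, with $$(a_1\otimes b_1)(a_2\otimes b_2)=(a_1\ast a_2)\otimes(b_1\diamond b_2)+(a_2\ast a_1)\otimes(b_2\diamond b_1),$$ $$[a_1\otimes b_1,a_2\otimes b_2]=(a_1\circ a_2)\otimes(b_1\diamond b_2)-(a_2\circ a_1)\otimes(b_2\diamond b_1).$$ Suppose that $r=\sum_i x_i\otimes y_i\in A\otimes A$ is a symmetric solution of the pre-Poisson Yang-Baxter equation in $(A,\ast,\circ)$. Then $$\widehat r=\sum_i\sum_{j\in\Omega}(x_i\otimes e_j)\otimes(y_i\otimes f_j)\in(A\otimes B)\,\hat\otimes\,(A\otimes B)$$ is a skew-symmetric completed solution of the Poisson Yang-Baxter equation in $(A\otimes B,\cdot,[-,-])$, where $\{e_j\}_{j\in\Omega}$ is a basis of $B$ consisting of homogeneous elements and $\{f_j\}_{j\in\Omega}$ is its homogeneous dual basis with respect to $\omega$, i.e. $\omega(f_i,e_j)=\delta_{ij}$.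
   Context: All vector spaces are over a field $\mathbf k$ of characteristic zero. A Zinbiel algebra $(A,\ast)$: $a_1\ast(a_2\ast a_3)=(a_1\ast a_2)\ast a_3+(a_2\ast a_1)\ast a_3$. A pre-Lie algebra $(A,\circ)$: $(a_1\circ a_2)\circ a_3-a_1\circ(a_2\circ a_3)=(a_2\circ a_1)\circ a_3-a_2\circ(a_1\circ a_3)$. A pre-Poisson algebra $(A,\ast,\circ)$: $(A,\ast)$ Zinbiel, $(A,\circ)$ pre-Lie, and $(a_1\circ a_2-a_2\circ a_1)\ast a_3=a_1\circ(a_2\ast a_3)-a_2\ast(a_1\circ a_3)$, $(a_1\ast a_2+a_2\ast a_1)\circ a_3=a_1\ast(a_2\circ a_3)+a_2\ast(a_1\circ a_3)$. Quadratic $\mathbb Z$-graded perm algebra $(B,\diamond,\omega)$: $b_1\diamond(b_2\diamond b_3)=(b_1\diamond b_2)\diamond b_3=(b_2\diamond b_1)\diamond b_3$; $B=\oplus_{i\in\mathbb Z}B_i$ with each $B_i$ finite-dimensional and $B_i\diamond B_j\subseteq B_{i+j}$; $\omega$ is an antisymmetric nondegenerate bilinear form with $\omega(b_1\diamond b_2,b_3)=\omega(b_1,b_2\diamond b_3-b_3\diamond b_2)$, and for some $m\in\mathbb Z$, $\omega(B_i,B_j)=0$ whenever $i+j+m\neq0$. Pre-Poisson Yang-Baxter equation (PPYBE) for $r=\sum_ix_i\otimes y_i\in A\otimes A$: $\mathbf Z_r=0$ and $\mathbf{PL}_r=0$, where $\mathbf Z_r=r_{13}\ast r_{12}+r_{23}\ast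 r_{21}+r_{13}\ast r_{23}+r_{23}\ast r_{13}-r_{12}\ast r_{23}-r_{23}\ast r_{12}-r_{13}\ast r_{21}-r_{21}\ast r_{13}$, $\mathbf{PL}_r=r_{13}\circ r_{12}+r_{23}\circ r_{12}+r_{21}\circ r_{13}+r_{23}\circ r_{13}-r_{23}\circ r_{21}-r_{12}\circ r_{23}-r_{13}\circ r_{21}-r_{13}\circ r_{23}$, and for $\star\in\{\ast,\circ\}$ (sums over $i,j$): $r_{13}\star r_{12}=(x_i\star x_j)\otimes y_j\otimes y_i$, $r_{23}\star r_{21}=y_j\otimes(x_i\star x_j)\otimes y_i$, $r_{13}\star r_{23}=x_i\otimes x_j\otimes(y_i\star y_j)$, $r_{23}\star r_{13}=x_j\otimes x_i\otimes(y_i\star y_j)$, $r_{12}\star r_{23}=x_i\otimes(y_i\star x_j)\otimes y_j$, $r_{23}\star r_{12}=x_j\otimes(x_i\star y_j)\otimes y_i$, $r_{13}\star r_{21}=(x_i\star y_j)\otimes x_j\otimes y_i$, $r_{21}\star r_{13}=(y_i\star x_j)\otimes x_i\otimes y_j$. "Symmetric" means $\tau(r)=r$, where $\tau(x\otimes y)=y\otimes x$. Completed tensor products of $\mathbb Z$-graded spaces: $U\hat\otimes V=\prod_{i,j\in\mathbb Z}U_i\otimes V_j$, similarly for three factors; $\hat\tau$ is the completed flip; $A\otimes B$ is graded by $A\otimes B_i$. For a $\mathbb Z$-graded Poisson algebra $P$, an element $r=\sum_\alpha x_\alpha\otimes y_\alpha\in P\hat\otimes P$ is a completed solution of the Poisson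 Yang-Baxter equation (PYBE) if, as elements of $P\hat\otimes P\hat\otimes P$, $\mathbf A_r=r_{12}r_{13}+r_{13}r_{23}-r_{23}r_{12}=0$ and $\mathbf C_r=[r_{12},r_{13}]+[r_{13},r_{23}]+[r_{12},r_{23}]=0$, where (sums over $\alpha,\beta$) $r_{12}r_{13}=x_\alpha x_\beta\otimes y_\alpha\otimes y_\beta$, $r_{13}r_{23}=x_\alpha\otimes x_\beta\otimes y_\alpha y_\beta$, $r_{23}r_{12}=x_\beta\otimes x_\alpha y_\beta\otimes y_\alpha$, $[r_{12},r_{13}]=[x_\alpha,x_\beta]\otimes y_\alpha\otimes y_\beta$, $[r_{13},r_{23}]=x_\alpha\otimes x_\beta\otimes[y_\alpha,y_\beta]$, $[r_{12},r_{23}]=x_\alpha\otimes[y_\alpha,x_\beta]\otimes y_\beta$. "Skew-symmetric" means $\hat\tau(r)=-r$. *)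

theory Defs
  imports Complex_Main "HOL-Library.Poly_Mapping"
begin

section \<open>Linear algebra\<close>

definition bilinear_map ::
  "('k::field \<Rightarrow> 'u::ab_group_add \<Rightarrow> 'u) \<Rightarrow> ('k \<Rightarrow> 'v::ab_group_add \<Rightarrow> 'v) \<Rightarrow>
   ('k \<Rightarrow> 'w::ab_group_add \<Rightarrow> 'w) \<Rightarrow> ('u \<Rightarrow> 'v \<Rightarrow> 'w) \<Rightarrow> bool" where
  "bilinear_map sU sV sW f \<longleftrightarrow>
     (\<forall>v. Vector_Spaces.linear sU sW (\<lambda>u. f u v)) \<and> (\<forall>u. Vector_Spaces.linear sV sW (f u))"

definition finite_dim_subspace ::
  "('k::field \<Rightarrow> 'v::ab_group_add \<Rightarrow> 'v) \<Rightarrow> 'v set \<Rightarrow> bool" where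
  "finite_dim_subspace s V \<longleftrightarrow> (\<exists>S. finite S \<and> module.span s S = V)"

definition is_grading ::
  "('k::field \<Rightarrow> 'v::ab_group_add \<Rightarrow> 'v) \<Rightarrow> (int \<Rightarrow> 'v set) \<Rightarrow> bool" where
  "is_grading s G \<longleftrightarrow>
     (\<forall>i. module.subspace s (G i)) \<and>
     (\<forall>v. \<exists>!g. (\<forall>i. g i \<in> G i) \<and> finite {i. g i \<noteq> 0} \<and> v = (\<Sum>i | g i \<noteq> 0. g i))"

definition homogeneous_basis ::
  "('k::field \<Rightarrow> 'v::ab_group_add \<Rightarrow> 'v) \<Rightarrow> (int \<Rightarrow> 'v set) \<Rightarrow> 'j set \<Rightarrow> ('j \<Rightarrow> 'v) \<Rightarrow> bool" where
  "homogeneous_basis s G \<Omega> e \<longleftrightarrow>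
     inj_on e \<Omega> \<and> \<not> module.dependent s (e ` \<Omega>) \<and> module.span s (e ` \<Omega>) = UNIV \<and>
     (\<forall>j\<in>\<Omega>. \<exists>d. e j \<in> G d)"


section \<open>Tensor products\<close>

text \<open>
  \<open>('u \<times> 'v) \<Rightarrow>\<^sub>0 'k\<close> is the free vector space on \<open>'u \<times> 'v\<close>.  A tensor product of two vector
  spaces is the quotient of this space by the span of the bilinearity relations.  A scalar
  action is an argument and not part of a type, so the quotient cannot be a type
  constructor; a tensor product is therefore a vector space \<open>'t\<close> with a map \<open>tens\<close> whose linear
  extension to the free space is onto and has exactly the span of these relations as its kernel.
\<close>

definition free_scale :: "'k::field \<Rightarrow> ('x \<Rightarrow>\<^sub>0 'k) \<Rightarrow> ('x \<Rightarrow>\<^sub>0 'k)" where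
  "free_scale c \<phi> = Poly_Mapping.map ((*) c) \<phi>"

definition bilinear_relations ::
  "('k::field \<Rightarrow> 'u::ab_group_add \<Rightarrow> 'u) \<Rightarrow> ('k \<Rightarrow> 'v::ab_group_add \<Rightarrow> 'v) \<Rightarrow> (('u \<times> 'v) \<Rightarrow>\<^sub>0 'k) set" where
  "bilinear_relations sU sV =
     {Poly_Mapping.single (u + u', v) 1 - Poly_Mapping.single (u, v) 1
        - Poly_Mapping.single (u', v) 1 | u u' v. True} \<union>
     {Poly_Mapping.single (u, v + v') 1 - Poly_Mapping.single (u, v) 1
        - Poly_Mapping.single (u, v') 1 | u v v'. True} \<union>
     {Poly_Mapping.single (sU c u, v) 1 - Poly_Mapping.single (u, v) c | c u v. True} \<union>
     {Poly_Mapping.single (u, sV c v) 1 - Poly_Mapping.single (u, v) c | c u v. True}"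

definition free_extension ::
  "('k::field \<Rightarrow> 'w::ab_group_add \<Rightarrow> 'w) \<Rightarrow> ('u \<Rightarrow> 'v \<Rightarrow> 'w) \<Rightarrow> (('u \<times> 'v) \<Rightarrow>\<^sub>0 'k) \<Rightarrow> 'w" where
  "free_extension sW f \<phi> =
     (\<Sum>p\<in>Poly_Mapping.keys \<phi>. sW (Poly_Mapping.lookup \<phi> p) (f (fst p) (snd p)))"

locale tensor_product =
  U: vector_space sU + V: vector_space sV + T: vector_space sT
  for sU :: "'k::field \<Rightarrow> 'u::ab_group_add \<Rightarrow> 'u"
    and sV :: "'k \<Rightarrow> 'v::ab_group_add \<Rightarrow> 'v"
    and sT :: "'k \<Rightarrow> 't::ab_group_add \<Rightarrow> 't" +
  fixes tens :: "'u \<Rightarrow> 'v \<Rightarrow> 't"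
  assumes surj_extension: "surj (free_extension sT tens)"
    and kernel_extension:
      "{\<phi>. free_extension sT tens \<phi> = 0} = module.span free_scale (bilinear_relations sU sV)"

definition tensor_lift ::
  "('k::field \<Rightarrow> 't::ab_group_add \<Rightarrow> 't) \<Rightarrow> ('k \<Rightarrow> 'w::ab_group_add \<Rightarrow> 'w) \<Rightarrow>
   ('u \<Rightarrow> 'v \<Rightarrow> 't) \<Rightarrow> ('u \<Rightarrow> 'v \<Rightarrow> 'w) \<Rightarrow> 't \<Rightarrow> 'w" where
  "tensor_lift sT sW tens f =
     (THE g. Vector_Spaces.linear sT sW g \<and> (\<forall>u v. g (tens u v) = f u v))"

text \<open>
  For \<open>r = (\<Sum>i. x i \<otimes> y i)\<close> and \<open>r' = (\<Sum>j. x' j \<otimes> y' j)\<close>, \<open>tensor_lift2\<close> is the double sum of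
  \<open>F (x i) (y i) (x' j) (y' j)\<close> over \<open>i\<close> and \<open>j\<close>, for \<open>F\<close> linear in each argument (lemma
  \<open>tensor_lift2_sum\<close> below).
\<close>

definition tensor_lift2 ::
  "('k::field \<Rightarrow> 't::ab_group_add \<Rightarrow> 't) \<Rightarrow> ('k \<Rightarrow> 'w::ab_group_add \<Rightarrow> 'w) \<Rightarrow>
   ('u \<Rightarrow> 'v \<Rightarrow> 't) \<Rightarrow> ('u \<Rightarrow> 'v \<Rightarrow> 'u \<Rightarrow> 'v \<Rightarrow> 'w) \<Rightarrow> 't \<Rightarrow> 't \<Rightarrow> 'w" where
  "tensor_lift2 sT sW tens F r r' =
     tensor_lift sT sW tens (\<lambda>x y. tensor_lift sT sW tens (F x y) r') r"

definition tensor_flip ::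
  "('k::field \<Rightarrow> 't::ab_group_add \<Rightarrow> 't) \<Rightarrow> ('u \<Rightarrow> 'u \<Rightarrow> 't) \<Rightarrow> 't \<Rightarrow> 't" where
  "tensor_flip sT tens = tensor_lift sT sT tens (\<lambda>u v. tens v u)"

text \<open>
  Over a field, the tensor product of subspaces \<open>U\<close> and \<open>V\<close> is identified with its image in the
  tensor product of the whole spaces.
\<close>

definition tensor_subspace ::
  "('k::field \<Rightarrow> 't::ab_group_add \<Rightarrow> 't) \<Rightarrow> ('u \<Rightarrow> 'v \<Rightarrow> 't) \<Rightarrow> 'u set \<Rightarrow> 'v set \<Rightarrow> 't set" where
  "tensor_subspace sT tens U V = module.span sT {tens u v | u v. u \<in> U \<and> v \<in> V}"


subsection \<open>The universal property\<close>

lemma lookup_free_scale [simp]: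
  "Poly_Mapping.lookup (free_scale c \<phi>) x = c * Poly_Mapping.lookup \<phi> x"
  by (auto simp: free_scale_def Poly_Mapping.map.rep_eq when_def)

lemma vector_space_free_scale: "vector_space free_scale"
  by unfold_locales (auto intro!: poly_mapping_eqI simp: lookup_add algebra_simps)

context vector_space
begin

lemma free_extension_superset:
  assumes "finite S" "Poly_Mapping.keys \<phi> \<subseteq> S"
  shows "free_extension scale f \<phi> =
    (\<Sum>p\<in>S. scale (Poly_Mapping.lookup \<phi> p) (f (fst p) (snd p)))"
  unfolding free_extension_def using assms
  by (intro sum.mono_neutral_left) (auto simp: in_keys_iff)

lemma linear_free_extension: "Vector_Spaces.linear free_scale scale (free_extension scale f)"
proof -
  interpret F: vector_space free_scale by (rule vector_space_free_scale)
  have add: "free_extension scale f (\<phi> + \<psi>) = free_extension scale f \<phi> + free_extension scale f \<psi>"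
    for \<phi> \<psi>
  proof -
    let ?S = "Poly_Mapping.keys \<phi> \<union> Poly_Mapping.keys \<psi>"
    have "Poly_Mapping.keys (\<phi> + \<psi>) \<subseteq> ?S" by (rule Poly_Mapping.keys_add)
    then show ?thesis
      by (simp add: free_extension_superset[of ?S] lookup_add scale_left_distrib sum.distrib)
  qed
  have scale: "free_extension scale f (free_scale c \<phi>) = scale c (free_extension scale f \<phi>)" for c \<phi>
  proof -
    have "Poly_Mapping.keys (free_scale c \<phi>) \<subseteq> Poly_Mapping.keys \<phi>"
      by (auto simp: in_keys_iff)
    then show ?thesis
      by (simp add: free_extension_superset[of "Poly_Mapping.keys \<phi>"] scale_sum_right)
  qed
  show ?thesis
    by unfold_locales (auto simp: add scale)
qed

lemma free_extension_single [simp]: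
  "free_extension scale f (Poly_Mapping.single (u, v) c) = scale c (f u v)"
  by (subst free_extension_superset[of "{(u, v)}"]) auto

end

context tensor_product
begin

lemma bilinear_tens: "bilinear_map sU sV sT tens"
proof -
  interpret E: Vector_Spaces.linear free_scale sT "free_extension sT tens"
    by (rule T.linear_free_extension)
  have rel: "free_extension sT tens \<phi> = 0" if "\<phi> \<in> bilinear_relations sU sV" for \<phi>
    using that kernel_extension E.vs1.span_base by blast
  have "tens (u + u') v = tens u v + tens u' v" for u u' v
  proof -
    have "Poly_Mapping.single (u + u', v) 1 - Poly_Mapping.single (u, v) 1
        - Poly_Mapping.single (u', v) 1 \<in> bilinear_relations sU sV"
      unfolding bilinear_relations_def by blast
    from rel[OF this] show ?thesis by (simp add: E.diff E.add diff_diff_eq)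
  qed
  moreover have "tens u (v + v') = tens u v + tens u v'" for u v v'
  proof -
    have "Poly_Mapping.single (u, v + v') 1 - Poly_Mapping.single (u, v) 1
        - Poly_Mapping.single (u, v') 1 \<in> bilinear_relations sU sV"
      unfolding bilinear_relations_def by blast
    from rel[OF this] show ?thesis by (simp add: E.diff E.add diff_diff_eq)
  qed
  moreover have "tens (sU c u) v = sT c (tens u v)" for c u v
  proof -
    have "Poly_Mapping.single (sU c u, v) 1 - Poly_Mapping.single (u, v) c
        \<in> bilinear_relations sU sV"
      unfolding bilinear_relations_def by blast
    from rel[OF this] show ?thesis by (simp add: E.diff)
  qed
  moreover have "tens u (sV c v) = sT c (tens u v)" for c u v
  proof -
    have "Poly_Mapping.single (u, sV c v) 1 - Poly_Mapping.single (u, v) c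
        \<in> bilinear_relations sU sV"
      unfolding bilinear_relations_def by blast
    from rel[OF this] show ?thesis by (simp add: E.diff)
  qed
  ultimately show ?thesis
    by (simp add: bilinear_map_def Vector_Spaces.linear_iff U.vector_space_axioms
        V.vector_space_axioms T.vector_space_axioms)
qed

lemma tensor_ext:
  assumes "Vector_Spaces.linear sT sW g" "Vector_Spaces.linear sT sW h"
    and "\<And>u v. g (tens u v) = h (tens u v)"
  shows "g = h"
proof
  fix t
  interpret g: Vector_Spaces.linear sT sW g by fact
  interpret h: Vector_Spaces.linear sT sW h by fact
  obtain \<phi> where "t = free_extension sT tens \<phi>"
    using surj_extension by (metis surjD)
  then show "g t = h t"
    by (simp add: free_extension_def g.sum h.sum g.scale h.scale assms(3))
qed

lemma universal_property:
  assumes f: "bilinear_map sU sV sW f"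
  shows "\<exists>!g. Vector_Spaces.linear sT sW g \<and> (\<forall>u v. g (tens u v) = f u v)"
proof -
  note f = f[unfolded bilinear_map_def Vector_Spaces.linear_iff]
  interpret W: vector_space sW using f by blast
  interpret E: Vector_Spaces.linear free_scale sT "free_extension sT tens"
    by (rule T.linear_free_extension)
  interpret F: Vector_Spaces.linear free_scale sW "free_extension sW f"
    by (rule W.linear_free_extension)
  have "bilinear_relations sU sV \<subseteq> {\<phi>. free_extension sW f \<phi> = 0}"
    using f by (auto simp: bilinear_relations_def F.diff)
  then have "module.span free_scale (bilinear_relations sU sV) \<subseteq> {\<phi>. free_extension sW f \<phi> = 0}"
    by (rule E.vs1.span_minimal) (rule F.subspace_kernel)
  then have ker: "free_extension sW f \<phi> = 0" if "free_extension sT tens \<phi> = 0" for \<phi>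
    using that kernel_extension by blast
  have eq: "free_extension sW f \<phi> = free_extension sW f \<psi>"
    if "free_extension sT tens \<phi> = free_extension sT tens \<psi>" for \<phi> \<psi>
    using ker[of "\<phi> - \<psi>"] that by (simp add: E.diff F.diff)
  define rep where "rep t = (SOME \<phi>. free_extension sT tens \<phi> = t)" for t
  have rep: "free_extension sT tens (rep t) = t" for t
    unfolding rep_def by (rule someI_ex) (metis surj_extension surjD)
  define g where "g t = free_extension sW f (rep t)" for t
  have "Vector_Spaces.linear sT sW g"
  proof unfold_locales
    show "g (s + t) = g s + g t" for s t
      unfolding g_def F.add[symmetric] by (rule eq) (simp add: rep E.add)
    show "g (sT c t) = sW c (g t)" for c t
      unfolding g_def F.scale[symmetric] by (rule eq) (simp add: rep E.scale)
  qed
  moreover have "g (tens u v) = f u v" for u v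
  proof -
    have "g (tens u v) = free_extension sW f (Poly_Mapping.single (u, v) 1)"
      unfolding g_def by (rule eq) (simp add: rep)
    then show ?thesis by simp
  qed
  ultimately show ?thesis
    by (intro ex1I[of _ g]) (auto intro: tensor_ext)
qed

lemma
  assumes "bilinear_map sU sV sW f"
  shows linear_tensor_lift: "Vector_Spaces.linear sT sW (tensor_lift sT sW tens f)"
    and tensor_lift_tens: "tensor_lift sT sW tens f (tens u v) = f u v"
  using theI'[OF universal_property[OF assms]] by (auto simp: tensor_lift_def)

lemma tensor_lift_sum:
  assumes "bilinear_map sU sV sW f"
  shows "tensor_lift sT sW tens f (\<Sum>i\<in>I. tens (x i) (y i)) = (\<Sum>i\<in>I. f (x i) (y i))"
proof -
  interpret L: Vector_Spaces.linear sT sW "tensor_lift sT sW tens f"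
    by (rule linear_tensor_lift) fact
  show ?thesis by (simp add: L.sum tensor_lift_tens[OF assms])
qed

lemma tensor_lift2_sum:
  assumes "\<And>x y. bilinear_map sU sV sW (F x y)" "\<And>x' y'. bilinear_map sU sV sW (\<lambda>x y. F x y x' y')"
  shows "tensor_lift2 sT sW tens F (\<Sum>i\<in>I. tens (x i) (y i)) (\<Sum>j\<in>J. tens (x' j) (y' j)) =
    (\<Sum>i\<in>I. \<Sum>j\<in>J. F (x i) (y i) (x' j) (y' j))"
proof -
  note F = assms(2)[unfolded bilinear_map_def Vector_Spaces.linear_iff]
  interpret W: vector_space sW using F by blast
  have "bilinear_map sU sV sW (\<lambda>u v. \<Sum>j\<in>J. F u v (x' j) (y' j))"
    using F by (simp add: bilinear_map_def Vector_Spaces.linear_iff sum.distrib W.scale_sum_right)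
  then show ?thesis
    by (simp add: tensor_lift2_def tensor_lift_sum assms(1))
qed

end


section \<open>Pre-Poisson algebras and quadratic graded perm algebras\<close>

locale zinbiel_algebra = vector_space scale
  for scale :: "'k::field \<Rightarrow> 'a::ab_group_add \<Rightarrow> 'a" +
  fixes zin :: "'a \<Rightarrow> 'a \<Rightarrow> 'a" (infixl "\<star>" 70)
  assumes bilinear_zin: "bilinear_map scale scale scale (\<star>)"
    and zinbiel: "a1 \<star> (a2 \<star> a3) = (a1 \<star> a2) \<star> a3 + (a2 \<star> a1) \<star> a3"

locale pre_lie_algebra = vector_space scale
  for scale :: "'k::field \<Rightarrow> 'a::ab_group_add \<Rightarrow> 'a" +
  fixes pre :: "'a \<Rightarrow> 'a \<Rightarrow> 'a" (infixl "\<odot>" 70)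
  assumes bilinear_pre: "bilinear_map scale scale scale (\<odot>)"
    and pre_lie: "(a1 \<odot> a2) \<odot> a3 - a1 \<odot> (a2 \<odot> a3) = (a2 \<odot> a1) \<odot> a3 - a2 \<odot> (a1 \<odot> a3)"

locale pre_poisson_algebra = zinbiel_algebra scale zin + pre_lie_algebra scale pre
  for scale :: "'k::field \<Rightarrow> 'a::ab_group_add \<Rightarrow> 'a"
    and zin :: "'a \<Rightarrow> 'a \<Rightarrow> 'a" (infixl "\<star>" 70)
    and pre :: "'a \<Rightarrow> 'a \<Rightarrow> 'a" (infixl "\<odot>" 70) +
  assumes pre_poisson1: "(a1 \<odot> a2 - a2 \<odot> a1) \<star> a3 = a1 \<odot> (a2 \<star> a3) - a2 \<star> (a1 \<odot> a3)"
    and pre_poisson2: "(a1 \<star> a2 + a2 \<star> a1) \<odot> a3 = a1 \<star> (a2 \<odot> a3) + a2 \<star> (a1 \<odot> a3)"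

locale quadratic_graded_perm_algebra = vector_space scale
  for scale :: "'k::field \<Rightarrow> 'b::ab_group_add \<Rightarrow> 'b" +
  fixes perm :: "'b \<Rightarrow> 'b \<Rightarrow> 'b" (infixl "\<diamondop>" 70)
    and G :: "int \<Rightarrow> 'b set"
    and \<omega> :: "'b \<Rightarrow> 'b \<Rightarrow> 'k"
  assumes bilinear_perm: "bilinear_map scale scale scale (\<diamondop>)"
    and perm_assoc: "b1 \<diamondop> (b2 \<diamondop> b3) = (b1 \<diamondop> b2) \<diamondop> b3"
    and perm_comm: "(b1 \<diamondop> b2) \<diamondop> b3 = (b2 \<diamondop> b1) \<diamondop> b3"
    and grading: "is_grading scale G"
    and finite_dim_pieces: "finite_dim_subspace scale (G i)"
    and graded_perm: "\<lbrakk>b1 \<in> G i; b2 \<in> G j\<rbrakk> \<Longrightarrow> b1 \<diamondop> b2 \<in> G (i + j)"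
    and bilinear_form: "bilinear_map scale scale (*) \<omega>"
    and antisymmetric: "\<omega> b1 b2 = - \<omega> b2 b1"
    and nondegenerate: "(\<And>b'. \<omega> b b' = 0) \<Longrightarrow> b = 0"
    and invariant: "\<omega> (b1 \<diamondop> b2) b3 = \<omega> b1 (b2 \<diamondop> b3 - b3 \<diamondop> b2)"
    and graded_form:
      "\<exists>m. \<forall>i j. i + j + m \<noteq> 0 \<longrightarrow> (\<forall>b1\<in>G i. \<forall>b2\<in>G j. \<omega> b1 b2 = 0)"

definition induced_mult ::
  "('k::field \<Rightarrow> 'p::ab_group_add \<Rightarrow> 'p) \<Rightarrow> ('a \<Rightarrow> 'b \<Rightarrow> 'p) \<Rightarrow>
   ('a \<Rightarrow> 'a \<Rightarrow> 'a) \<Rightarrow> ('b \<Rightarrow> 'b \<Rightarrow> 'b) \<Rightarrow> 'p \<Rightarrow> 'p \<Rightarrow> 'p" where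
  "induced_mult sP tens zin perm = tensor_lift2 sP sP tens
     (\<lambda>a1 b1 a2 b2. tens (zin a1 a2) (perm b1 b2) + tens (zin a2 a1) (perm b2 b1))"

definition induced_bracket ::
  "('k::field \<Rightarrow> 'p::ab_group_add \<Rightarrow> 'p) \<Rightarrow> ('a \<Rightarrow> 'b \<Rightarrow> 'p) \<Rightarrow>
   ('a \<Rightarrow> 'a \<Rightarrow> 'a) \<Rightarrow> ('b \<Rightarrow> 'b \<Rightarrow> 'b) \<Rightarrow> 'p \<Rightarrow> 'p \<Rightarrow> 'p" where
  "induced_bracket sP tens pre perm = tensor_lift2 sP sP tens
     (\<lambda>a1 b1 a2 b2. tens (pre a1 a2) (perm b1 b2) - tens (pre a2 a1) (perm b2 b1))"

definition induced_grading ::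
  "('k::field \<Rightarrow> 'p::ab_group_add \<Rightarrow> 'p) \<Rightarrow> ('a \<Rightarrow> 'b \<Rightarrow> 'p) \<Rightarrow> (int \<Rightarrow> 'b set) \<Rightarrow> int \<Rightarrow> 'p set" where
  "induced_grading sP tens G i = tensor_subspace sP tens UNIV (G i)"


section \<open>The pre-Poisson Yang-Baxter equation\<close>

text \<open>
  In this and the next section, \<open>t2\<close> and \<open>t3\<close> are the tensor maps of \<open>V \<otimes> V\<close> and of
  \<open>(V \<otimes> V) \<otimes> V\<close>.  In the arguments of \<open>tensor_lift2\<close>, the letters \<open>x y\<close> stand for
  the first summation index and \<open>x' y'\<close> for the second one.
\<close>

definition ppybe_Z ::
  "('k::field \<Rightarrow> 'aa::ab_group_add \<Rightarrow> 'aa) \<Rightarrow> ('k \<Rightarrow> 'aaa::ab_group_add \<Rightarrow> 'aaa) \<Rightarrow>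
   ('a \<Rightarrow> 'a \<Rightarrow> 'aa) \<Rightarrow> ('aa \<Rightarrow> 'a \<Rightarrow> 'aaa) \<Rightarrow> ('a \<Rightarrow> 'a \<Rightarrow> 'a) \<Rightarrow> 'aa \<Rightarrow> 'aaa" where
  "ppybe_Z s2 s3 t2 t3 m r =
    (let T = (\<lambda>u v w. t3 (t2 u v) w);
         S = (\<lambda>F. tensor_lift2 s2 s3 t2 F r r);
         r13_r12 = S (\<lambda>x y x' y'. T (m x x') y' y);
         r23_r21 = S (\<lambda>x y x' y'. T y' (m x x') y);
         r13_r23 = S (\<lambda>x y x' y'. T x x' (m y y'));
         r23_r13 = S (\<lambda>x y x' y'. T x' x (m y y'));
         r12_r23 = S (\<lambda>x y x' y'. T x (m y x') y');
         r23_r12 = S (\<lambda>x y x' y'. T x' (m x y') y);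
         r13_r21 = S (\<lambda>x y x' y'. T (m x y') x' y);
         r21_r13 = S (\<lambda>x y x' y'. T (m y x') x y')
     in r13_r12 + r23_r21 + r13_r23 + r23_r13 - r12_r23 - r23_r12 - r13_r21 - r21_r13)"

definition ppybe_PL ::
  "('k::field \<Rightarrow> 'aa::ab_group_add \<Rightarrow> 'aa) \<Rightarrow> ('k \<Rightarrow> 'aaa::ab_group_add \<Rightarrow> 'aaa) \<Rightarrow>
   ('a \<Rightarrow> 'a \<Rightarrow> 'aa) \<Rightarrow> ('aa \<Rightarrow> 'a \<Rightarrow> 'aaa) \<Rightarrow> ('a \<Rightarrow> 'a \<Rightarrow> 'a) \<Rightarrow> 'aa \<Rightarrow> 'aaa" where
  "ppybe_PL s2 s3 t2 t3 m r =
    (let T = (\<lambda>u v w. t3 (t2 u v) w);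
         S = (\<lambda>F. tensor_lift2 s2 s3 t2 F r r);
         r13_r12 = S (\<lambda>x y x' y'. T (m x x') y' y);
         r23_r21 = S (\<lambda>x y x' y'. T y' (m x x') y);
         r13_r23 = S (\<lambda>x y x' y'. T x x' (m y y'));
         r23_r13 = S (\<lambda>x y x' y'. T x' x (m y y'));
         r12_r23 = S (\<lambda>x y x' y'. T x (m y x') y');
         r23_r12 = S (\<lambda>x y x' y'. T x' (m x y') y);
         r13_r21 = S (\<lambda>x y x' y'. T (m x y') x' y);
         r21_r13 = S (\<lambda>x y x' y'. T (m y x') x y')
     in r13_r12 + r23_r12 + r21_r13 + r23_r13 - r23_r21 - r12_r23 - r13_r21 - r13_r23)"

definition ppybe_solution ::
  "('k::field \<Rightarrow> 'aa::ab_group_add \<Rightarrow> 'aa) \<Rightarrow> ('k \<Rightarrow> 'aaa::ab_group_add \<Rightarrow> 'aaa) \<Rightarrow>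
   ('a \<Rightarrow> 'a \<Rightarrow> 'aa) \<Rightarrow> ('aa \<Rightarrow> 'a \<Rightarrow> 'aaa) \<Rightarrow> ('a \<Rightarrow> 'a \<Rightarrow> 'a) \<Rightarrow> ('a \<Rightarrow> 'a \<Rightarrow> 'a) \<Rightarrow> 'aa \<Rightarrow> bool" where
  "ppybe_solution s2 s3 t2 t3 zin pre r \<longleftrightarrow>
     ppybe_Z s2 s3 t2 t3 zin r = 0 \<and> ppybe_PL s2 s3 t2 t3 pre r = 0"


section \<open>Completed tensor products and the Poisson Yang-Baxter equation\<close>

text \<open>An element of the completed tensor square is the family of its bihomogeneous components.\<close>

definition completed_tensor_square ::
  "('k::field \<Rightarrow> 'pp::ab_group_add \<Rightarrow> 'pp) \<Rightarrow> ('p \<Rightarrow> 'p \<Rightarrow> 'pp) \<Rightarrow> (int \<Rightarrow> 'p set) \<Rightarrow>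
   (int \<Rightarrow> int \<Rightarrow> 'pp) set" where
  "completed_tensor_square s2 t2 P = {r. \<forall>i j. r i j \<in> tensor_subspace s2 t2 (P i) (P j)}"

definition completed_flip ::
  "('k::field \<Rightarrow> 'pp::ab_group_add \<Rightarrow> 'pp) \<Rightarrow> ('p \<Rightarrow> 'p \<Rightarrow> 'pp) \<Rightarrow>
   (int \<Rightarrow> int \<Rightarrow> 'pp) \<Rightarrow> int \<Rightarrow> int \<Rightarrow> 'pp" where
  "completed_flip s2 t2 r i j = tensor_flip s2 t2 (r j i)"

definition completed_skew_symmetric ::
  "('k::field \<Rightarrow> 'pp::ab_group_add \<Rightarrow> 'pp) \<Rightarrow> ('p \<Rightarrow> 'p \<Rightarrow> 'pp) \<Rightarrow> (int \<Rightarrow> int \<Rightarrow> 'pp) \<Rightarrow> bool" where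
  "completed_skew_symmetric s2 t2 r \<longleftrightarrow> (\<forall>i j. completed_flip s2 t2 r i j = - r i j)"

text \<open>
  \<open>F\<close> sends bihomogeneous elements \<open>x \<otimes> y\<close> of degree \<open>(i, j)\<close> and \<open>x' \<otimes> y'\<close> of degree \<open>(k, l)\<close>
  to an element of degree \<open>d i j k l\<close> of the tensor cube.  The component of degree \<open>n\<close> of the
  sum over all pairs of terms of \<open>r\<close> is the sum over those \<open>(i, j, k, l)\<close> that
  \<open>d\<close> maps to \<open>n\<close>; it exists when only finitely many of them contribute.
\<close>

definition contributing_degrees ::
  "('k::field \<Rightarrow> 'pp::ab_group_add \<Rightarrow> 'pp) \<Rightarrow> ('k \<Rightarrow> 'ppp::ab_group_add \<Rightarrow> 'ppp) \<Rightarrow> ('p \<Rightarrow> 'p \<Rightarrow> 'pp) \<Rightarrow>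
   (int \<Rightarrow> int \<Rightarrow> int \<Rightarrow> int \<Rightarrow> int \<times> int \<times> int) \<Rightarrow> ('p \<Rightarrow> 'p \<Rightarrow> 'p \<Rightarrow> 'p \<Rightarrow> 'ppp) \<Rightarrow>
   (int \<Rightarrow> int \<Rightarrow> 'pp) \<Rightarrow> int \<times> int \<times> int \<Rightarrow> (int \<times> int \<times> int \<times> int) set" where
  "contributing_degrees s2 s3 t2 d F r n =
     {(i, j, k, l). d i j k l = n \<and> tensor_lift2 s2 s3 t2 F (r i j) (r k l) \<noteq> 0}"

definition completed_exists ::
  "('k::field \<Rightarrow> 'pp::ab_group_add \<Rightarrow> 'pp) \<Rightarrow> ('k \<Rightarrow> 'ppp::ab_group_add \<Rightarrow> 'ppp) \<Rightarrow> ('p \<Rightarrow> 'p \<Rightarrow> 'pp) \<Rightarrow>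
   (int \<Rightarrow> int \<Rightarrow> int \<Rightarrow> int \<Rightarrow> int \<times> int \<times> int) \<Rightarrow> ('p \<Rightarrow> 'p \<Rightarrow> 'p \<Rightarrow> 'p \<Rightarrow> 'ppp) \<Rightarrow>
   (int \<Rightarrow> int \<Rightarrow> 'pp) \<Rightarrow> bool" where
  "completed_exists s2 s3 t2 d F r \<longleftrightarrow> (\<forall>n. finite (contributing_degrees s2 s3 t2 d F r n))"

definition completed_sum ::
  "('k::field \<Rightarrow> 'pp::ab_group_add \<Rightarrow> 'pp) \<Rightarrow> ('k \<Rightarrow> 'ppp::ab_group_add \<Rightarrow> 'ppp) \<Rightarrow> ('p \<Rightarrow> 'p \<Rightarrow> 'pp) \<Rightarrow>
   (int \<Rightarrow> int \<Rightarrow> int \<Rightarrow> int \<Rightarrow> int \<times> int \<times> int) \<Rightarrow> ('p \<Rightarrow> 'p \<Rightarrow> 'p \<Rightarrow> 'p \<Rightarrow> 'ppp) \<Rightarrow>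
   (int \<Rightarrow> int \<Rightarrow> 'pp) \<Rightarrow> int \<times> int \<times> int \<Rightarrow> 'ppp" where
  "completed_sum s2 s3 t2 d F r n =
     (\<Sum>(i, j, k, l)\<in>contributing_degrees s2 s3 t2 d F r n.
        tensor_lift2 s2 s3 t2 F (r i j) (r k l))"

definition pybe_A ::
  "('k::field \<Rightarrow> 'pp::ab_group_add \<Rightarrow> 'pp) \<Rightarrow> ('k \<Rightarrow> 'ppp::ab_group_add \<Rightarrow> 'ppp) \<Rightarrow>
   ('p \<Rightarrow> 'p \<Rightarrow> 'pp) \<Rightarrow> ('pp \<Rightarrow> 'p \<Rightarrow> 'ppp) \<Rightarrow> ('p \<Rightarrow> 'p \<Rightarrow> 'p) \<Rightarrow>
   (int \<Rightarrow> int \<Rightarrow> 'pp) \<Rightarrow> bool" where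
  "pybe_A s2 s3 t2 t3 mul r \<longleftrightarrow>
    (let T = (\<lambda>u v w. t3 (t2 u v) w);
         ex = (\<lambda>d F. completed_exists s2 s3 t2 d F r);
         S = (\<lambda>d F. completed_sum s2 s3 t2 d F r);
         d12_13 = (\<lambda>i j k l. (i + k, j, l)); r12_r13 = (\<lambda>x y x' y'. T (mul x x') y y');
         d13_23 = (\<lambda>i j k l. (i, k, j + l)); r13_r23 = (\<lambda>x y x' y'. T x x' (mul y y'));
         d23_12 = (\<lambda>i j k l. (k, i + l, j)); r23_r12 = (\<lambda>x y x' y'. T x' (mul x y') y)
     in ex d12_13 r12_r13 \<and> ex d13_23 r13_r23 \<and> ex d23_12 r23_r12 \<and>
        (\<forall>n. S d12_13 r12_r13 n + S d13_23 r13_r23 n - S d23_12 r23_r12 n = 0))"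

definition pybe_C ::
  "('k::field \<Rightarrow> 'pp::ab_group_add \<Rightarrow> 'pp) \<Rightarrow> ('k \<Rightarrow> 'ppp::ab_group_add \<Rightarrow> 'ppp) \<Rightarrow>
   ('p \<Rightarrow> 'p \<Rightarrow> 'pp) \<Rightarrow> ('pp \<Rightarrow> 'p \<Rightarrow> 'ppp) \<Rightarrow> ('p \<Rightarrow> 'p \<Rightarrow> 'p) \<Rightarrow>
   (int \<Rightarrow> int \<Rightarrow> 'pp) \<Rightarrow> bool" where
  "pybe_C s2 s3 t2 t3 br r \<longleftrightarrow>
    (let T = (\<lambda>u v w. t3 (t2 u v) w);
         ex = (\<lambda>d F. completed_exists s2 s3 t2 d F r);
         S = (\<lambda>d F. completed_sum s2 s3 t2 d F r);
         d12_13 = (\<lambda>i j k l. (i + k, j, l)); r12_r13 = (\<lambda>x y x' y'. T (br x x') y y');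
         d13_23 = (\<lambda>i j k l. (i, k, j + l)); r13_r23 = (\<lambda>x y x' y'. T x x' (br y y'));
         d12_23 = (\<lambda>i j k l. (i, j + k, l)); r12_r23 = (\<lambda>x y x' y'. T x (br y x') y')
     in ex d12_13 r12_r13 \<and> ex d13_23 r13_r23 \<and> ex d12_23 r12_r23 \<and>
        (\<forall>n. S d12_13 r12_r13 n + S d13_23 r13_r23 n + S d12_23 r12_r23 n = 0))"

definition completed_pybe_solution ::
  "('k::field \<Rightarrow> 'pp::ab_group_add \<Rightarrow> 'pp) \<Rightarrow> ('k \<Rightarrow> 'ppp::ab_group_add \<Rightarrow> 'ppp) \<Rightarrow>
   ('p \<Rightarrow> 'p \<Rightarrow> 'pp) \<Rightarrow> ('pp \<Rightarrow> 'p \<Rightarrow> 'ppp) \<Rightarrow> (int \<Rightarrow> 'p set) \<Rightarrow>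
   ('p \<Rightarrow> 'p \<Rightarrow> 'p) \<Rightarrow> ('p \<Rightarrow> 'p \<Rightarrow> 'p) \<Rightarrow> (int \<Rightarrow> int \<Rightarrow> 'pp) \<Rightarrow> bool" where
  "completed_pybe_solution s2 s3 t2 t3 P mul br r \<longleftrightarrow>
     r \<in> completed_tensor_square s2 t2 P \<and> pybe_A s2 s3 t2 t3 mul r \<and> pybe_C s2 s3 t2 t3 br r"

text \<open>
  The component of degree \<open>(p, q)\<close> of the sum of all \<open>(x i \<otimes> e j) \<otimes> (y i \<otimes> f j)\<close>, where
  \<open>tP\<close> is the tensor map of \<open>P = A \<otimes> B\<close>.  For a homogeneous basis \<open>e\<close>, the inner sum is finite
  because \<open>G p\<close> is finite-dimensional.
\<close>

definition r_hat ::
  "('p \<Rightarrow> 'p \<Rightarrow> 'pp::ab_group_add) \<Rightarrow> ('a \<Rightarrow> 'b \<Rightarrow> 'p) \<Rightarrow> (int \<Rightarrow> 'b set) \<Rightarrow>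
   'i set \<Rightarrow> ('i \<Rightarrow> 'a) \<Rightarrow> ('i \<Rightarrow> 'a) \<Rightarrow> 'j set \<Rightarrow> ('j \<Rightarrow> 'b) \<Rightarrow> ('j \<Rightarrow> 'b) \<Rightarrow> int \<Rightarrow> int \<Rightarrow> 'pp" where
  "r_hat t2 tP G I x y \<Omega> e f p q =
     (\<Sum>i\<in>I. \<Sum>j | j \<in> \<Omega> \<and> e j \<in> G p \<and> f j \<in> G q. t2 (tP (x i) (e j)) (tP (y i) (f j)))"

end

theory Submission
  imports Defs
begin

text \<open>
  The components of the Casimir element \<open>\<Sum>e\<^sub>j \<otimes> f\<^sub>j\<close> are antisymmetric (\<open>casimir_swap\<close>), which gives
  skew-symmetry.  For the Yang-Baxter equation, the trilinear form \<open>\<omega> (u \<diamondop> v) w\<close> is antisymmetric in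
  \<open>v\<close>, \<open>w\<close> and its cyclic sum vanishes, so that every contraction of two Casimir elements by the product
  of \<open>B\<close> is a combination of \<open>E1 = \<Sum>(e\<^sub>j \<diamondop> e\<^sub>l) \<otimes> f\<^sub>j \<otimes> f\<^sub>l\<close> and \<open>E2 = \<Sum>(e\<^sub>l \<diamondop> e\<^sub>j) \<otimes> f\<^sub>j \<otimes> f\<^sub>l\<close>.
  For symmetric \<open>r\<close> this gives \<open>A = - Z \<cdot> E1 - \<sigma>(Z) \<cdot> E2\<close> and \<open>C = PL \<cdot> E1 - \<sigma>(PL) \<cdot> E2\<close>, where \<open>\<sigma>\<close>
  exchanges the last two factors.  The form pairs degree \<open>p\<close> with degree \<open>- m - p\<close>, hence each
  component of each completed sum involves at most one pair of bihomogeneous components of the tensor.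
\<close>

section \<open>Multilinear maps and tensor products\<close>

lemma bilinear_map_alt:
  "bilinear_map sU sV sW f \<longleftrightarrow> vector_space sU \<and> vector_space sV \<and> vector_space sW \<and>
    (\<forall>u u' v. f (u + u') v = f u v + f u' v) \<and> (\<forall>c u v. f (sU c u) v = sW c (f u v)) \<and>
    (\<forall>u v v'. f u (v + v') = f u v + f u v') \<and> (\<forall>c u v. f u (sV c v) = sW c (f u v))"
  by (auto simp: bilinear_map_def Vector_Spaces.linear_iff)

text \<open>The expansion is a premise rather than a rewrite of the conclusion, so that
  \<open>expand_e\<close> and \<open>expand_f\<close> can be supplied as rules; as rewrite rules
  they would loop, since the vector recurs in its own coefficients.\<close>

lemma
  assumes "bilinear_map sU sV sW f"
  shows bilinear_map_expand_left:
      "u = (\<Sum>i\<in>S. sU (c i) (u' i)) \<Longrightarrow> f u v = (\<Sum>i\<in>S. sW (c i) (f (u' i) v))"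
    and bilinear_map_expand_right:
      "v = (\<Sum>i\<in>S. sV (c i) (v' i)) \<Longrightarrow> f u v = (\<Sum>i\<in>S. sW (c i) (f u (v' i)))"
    and bilinear_map_zero: "f 0 v = 0" "f u 0 = 0"
    and bilinear_map_minus: "f (- u) v = - f u v" "f u (- v) = - f u v"
proof -
  interpret left: Vector_Spaces.linear sU sW "\<lambda>u. f u v" using assms by (simp add: bilinear_map_def)
  interpret right: Vector_Spaces.linear sV sW "f u" using assms by (simp add: bilinear_map_def)
  show "u = (\<Sum>i\<in>S. sU (c i) (u' i)) \<Longrightarrow> f u v = (\<Sum>i\<in>S. sW (c i) (f (u' i) v))"
    by (simp add: left.sum left.scale)
  show "v = (\<Sum>i\<in>S. sV (c i) (v' i)) \<Longrightarrow> f u v = (\<Sum>i\<in>S. sW (c i) (f u (v' i)))"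
    by (simp add: right.sum right.scale)
  show "f 0 v = 0" "f u 0 = 0" "f (- u) v = - f u v" "f u (- v) = - f u v"
    by (simp_all add: left.zero right.zero left.neg right.neg)
qed

definition trilinear_map ::
  "('k::field \<Rightarrow> 'u::ab_group_add \<Rightarrow> 'u) \<Rightarrow> ('k \<Rightarrow> 'v::ab_group_add \<Rightarrow> 'v) \<Rightarrow>
   ('k \<Rightarrow> 'x::ab_group_add \<Rightarrow> 'x) \<Rightarrow> ('k \<Rightarrow> 'w::ab_group_add \<Rightarrow> 'w) \<Rightarrow>
   ('u \<Rightarrow> 'v \<Rightarrow> 'x \<Rightarrow> 'w) \<Rightarrow> bool" where
  "trilinear_map sU sV sX sW f \<longleftrightarrow>
     (\<forall>x. bilinear_map sU sV sW (\<lambda>u v. f u v x)) \<and> (\<forall>u. bilinear_map sV sX sW (f u))"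

lemma trilinear_map_alt:
  "trilinear_map sU sV sX sW f \<longleftrightarrow>
    vector_space sU \<and> vector_space sV \<and> vector_space sX \<and> vector_space sW \<and>
    (\<forall>u u' v x. f (u + u') v x = f u v x + f u' v x) \<and>
    (\<forall>c u v x. f (sU c u) v x = sW c (f u v x)) \<and>
    (\<forall>u v v' x. f u (v + v') x = f u v x + f u v' x) \<and>
    (\<forall>c u v x. f u (sV c v) x = sW c (f u v x)) \<and>
    (\<forall>u v x x'. f u v (x + x') = f u v x + f u v x') \<and>
    (\<forall>c u v x. f u v (sX c x) = sW c (f u v x))"
  unfolding trilinear_map_def bilinear_map_alt by auto

text \<open>This is the exchange \<sigma> of the last two tensor factors, transferred to the maps
  used for testing; it lets the pre-Poisson equation be paired with \<open>E2\<close> in swapped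
  order.\<close>

lemma trilinear_map_swap23:
  "trilinear_map sU sV sX sW f \<Longrightarrow> trilinear_map sU sX sV sW (\<lambda>u x v. f u v x)"
  unfolding trilinear_map_alt by simp

lemma trilinear_map_sum:
  assumes "\<And>i. trilinear_map sU sV sX sW (f i)"
  shows "trilinear_map sU sV sX sW (\<lambda>u v x. \<Sum>i\<in>S. f i u v x)"
proof -
  interpret W: vector_space sW using assms by (simp add: trilinear_map_alt)
  show ?thesis
    using assms by (simp add: trilinear_map_alt sum.distrib W.scale_sum_right)
qed

section \<open>Sums of pure tensors and factorization of multilinear maps\<close>

context tensor_product
begin

text \<open>A preimage under the surjective free extension gives a linear combination of pure
  tensors, and bilinearity absorbs the coefficients into the left factors. The keys of the preimage
  index the sum, whence the index type.\<close>

lemma ex_sum_tens: "\<exists>(S :: ('u \<times> 'v) set) x y. t = (\<Sum>i\<in>S. tens (x i) (y i))"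
proof -
  note b = bilinear_tens[unfolded bilinear_map_alt]
  obtain \<phi> where "t = free_extension sT tens \<phi>"
    using surj_extension by (metis surjD)
  then have "t = (\<Sum>p\<in>Poly_Mapping.keys \<phi>. tens (sU (Poly_Mapping.lookup \<phi> p) (fst p)) (snd p))"
    using b by (simp add: free_extension_def)
  then show ?thesis
    by (intro exI[of _ "Poly_Mapping.keys \<phi>"] exI[of _ "\<lambda>p. sU (Poly_Mapping.lookup \<phi> p) (fst p)"] exI[of _ snd])
qed

text \<open>Linearity in the outer argument is that of a lift, once the inner lift is known to be
  bilinear in \<open>x\<close> and \<open>y\<close>; linearity in the inner argument follows by
  writing the outer one as a sum of pure tensors.\<close>

lemma bilinear_tensor_lift2:
  assumes F: "\<And>x y. bilinear_map sU sV sW (F x y)" "\<And>x' y'. bilinear_map sU sV sW (\<lambda>x y. F x y x' y')"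
  shows "bilinear_map sT sT sW (tensor_lift2 sT sW tens F)"
proof -
  interpret W: vector_space sW using F(1) by (simp add: bilinear_map_alt)
  have "bilinear_map sU sV sW (\<lambda>x y. tensor_lift sT sW tens (F x y) t')" for t'
  proof -
    obtain S :: "('u \<times> 'v) set" and x' y' where "t' = (\<Sum>i\<in>S. tens (x' i) (y' i))" using ex_sum_tens[of t'] by blast
    then show ?thesis
      using F by (simp add: tensor_lift_sum[OF F(1)] bilinear_map_alt sum.distrib W.scale_sum_right)
  qed
  note lift = this
  have left: "Vector_Spaces.linear sT sW (\<lambda>t. tensor_lift2 sT sW tens F t t')" for t'
    unfolding tensor_lift2_def by (rule linear_tensor_lift[OF lift])
  have "Vector_Spaces.linear sT sW (tensor_lift2 sT sW tens F t)" for t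
  proof -
    obtain S :: "('u \<times> 'v) set" and x y where "t = (\<Sum>i\<in>S. tens (x i) (y i))" using ex_sum_tens[of t] by blast
    then have "tensor_lift2 sT sW tens F t = (\<lambda>t'. \<Sum>i\<in>S. tensor_lift sT sW tens (F (x i) (y i)) t')"
      by (simp add: fun_eq_iff tensor_lift2_def tensor_lift_sum[OF lift])
    moreover have "tensor_lift sT sW tens (F x y) (s + t) =
        tensor_lift sT sW tens (F x y) s + tensor_lift sT sW tens (F x y) t"
      "tensor_lift sT sW tens (F x y) (sT c s) = sW c (tensor_lift sT sW tens (F x y) s)" for x y s t c
      using linear_tensor_lift[OF F(1)[of x y]] by (simp_all only: Vector_Spaces.linear_iff)
    ultimately show ?thesis
      by (simp add: Vector_Spaces.linear_iff sum.distrib W.scale_sum_right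
          T.vector_space_axioms W.vector_space_axioms)
  qed
  with left show ?thesis unfolding bilinear_map_def by blast
qed

end

text \<open>The universal property is used twice: \<open>\<eta>\<close> lifts the first two slots,
  with the third as a parameter, and is then lifted itself. Thus an equation in the tensor cube can
  be evaluated on any trilinear map.\<close>

lemma trilinear_factors_through_tensor:
  fixes sU :: "'k::field \<Rightarrow> 'u::ab_group_add \<Rightarrow> 'u" and sV :: "'k \<Rightarrow> 'v::ab_group_add \<Rightarrow> 'v"
  assumes UV: "tensor_product sU sV sT tens" and TX: "tensor_product sT sX sY tens'"
    and \<theta>: "trilinear_map sU sV sX sW \<theta>"
  shows "\<exists>L. Vector_Spaces.linear sY sW L \<and> (\<forall>u v x. L (tens' (tens u v) x) = \<theta> u v x)"
proof -
  interpret UV: tensor_product sU sV sT tens by fact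
  interpret TX: tensor_product sT sX sY tens' by fact
  interpret W: vector_space sW using \<theta> by (simp add: trilinear_map_alt)
  define \<eta> where "\<eta> t x = tensor_lift sT sW tens (\<lambda>u v. \<theta> u v x) t" for t x
  have b: "bilinear_map sU sV sW (\<lambda>u v. \<theta> u v x)" for x using \<theta> by (simp add: trilinear_map_def)
  have "Vector_Spaces.linear sX sW (\<eta> t)" for t
  proof -
    obtain S :: "('u \<times> 'v) set" and y z where "t = (\<Sum>i\<in>S. tens (y i) (z i))" using UV.ex_sum_tens[of t] by blast
    then have "\<eta> t = (\<lambda>x. \<Sum>i\<in>S. \<theta> (y i) (z i) x)"
      by (simp add: fun_eq_iff \<eta>_def UV.tensor_lift_sum[OF b])
    then show ?thesis
      using \<theta> by (simp add: trilinear_map_alt Vector_Spaces.linear_iff sum.distrib W.scale_sum_right)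
  qed
  then have "bilinear_map sT sX sW \<eta>"
    using UV.linear_tensor_lift[OF b] by (simp add: bilinear_map_def \<eta>_def)
  from TX.universal_property[OF this] show ?thesis
    by (auto simp: \<eta>_def UV.tensor_lift_tens[OF b])
qed


section \<open>The Yang-Baxter equation for symmetric tensors\<close>

locale symmetric_tensor =
  AA: tensor_product sA sA sAA tAA
  for sA :: "'k::field \<Rightarrow> 'a::ab_group_add \<Rightarrow> 'a" and sAA :: "'k \<Rightarrow> 'aa::ab_group_add \<Rightarrow> 'aa"
    and tAA :: "'a \<Rightarrow> 'a \<Rightarrow> 'aa" +
  fixes r :: 'aa and I :: "'i set" and x y :: "'i \<Rightarrow> 'a"
  assumes r: "r = (\<Sum>i\<in>I. tAA (x i) (y i))"
    and symmetric: "tensor_flip sAA tAA r = r"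
begin

text \<open>The linear lift of \<open>g\<close>, applied to both expressions of \<open>r\<close>,
  gives the exchange. All later arguments use the symmetry of \<open>r\<close> in this form.\<close>

lemma sum_swap:
  assumes g: "bilinear_map sA sA sW g"
  shows "(\<Sum>i\<in>I. g (y i) (x i)) = (\<Sum>i\<in>I. g (x i) (y i))"
proof -
  have "bilinear_map sA sA sAA (\<lambda>u v. tAA v u)"
    using AA.bilinear_tens by (simp add: bilinear_map_alt)
  then have "(\<Sum>i\<in>I. tAA (y i) (x i)) = r"
    using symmetric AA.tensor_lift_sum[of sAA "\<lambda>u v. tAA v u" x y I] by (simp add: r tensor_flip_def)
  then show ?thesis
    using AA.tensor_lift_sum[OF g, of y x I] AA.tensor_lift_sum[OF g, of x y I] by (simp add: r)
qed

section \<open>The pre-Poisson Yang-Baxter equation evaluated on a trilinear map\<close>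

context
  fixes sW :: "'k \<Rightarrow> 'w::ab_group_add \<Rightarrow> 'w" and m \<theta>
  assumes m: "bilinear_map sA sA sA m" and \<theta>: "trilinear_map sA sA sA sW \<theta>"
begin

lemmas multilinear = m[unfolded bilinear_map_alt] \<theta>[unfolded trilinear_map_alt]

text \<open>Exchanging \<open>x\<close> and \<open>y\<close> in one or both copies of
  \<open>r\<close> moves every product onto the \<open>x\<close> entries. Six standard sums remain,
  given by the slot of the product and the order of its factors.\<close>

lemma sums_normal_form:
  shows "(\<Sum>i\<in>I. \<Sum>k\<in>I. \<theta> (m (x i) (y k)) (x k) (y i)) = (\<Sum>i\<in>I. \<Sum>k\<in>I. \<theta> (m (x k) (x i)) (y i) (y k))"
    and "(\<Sum>i\<in>I. \<Sum>k\<in>I. \<theta> (m (y i) (x k)) (x i) (y k)) = (\<Sum>i\<in>I. \<Sum>k\<in>I. \<theta> (m (x i) (x k)) (y i) (y k))"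
    and "(\<Sum>i\<in>I. \<Sum>k\<in>I. \<theta> (x i) (m (y i) (x k)) (y k)) = (\<Sum>i\<in>I. \<Sum>k\<in>I. \<theta> (y i) (m (x i) (x k)) (y k))"
    and "(\<Sum>i\<in>I. \<Sum>k\<in>I. \<theta> (x i) (m (x k) (y i)) (y k)) = (\<Sum>i\<in>I. \<Sum>k\<in>I. \<theta> (y i) (m (x k) (x i)) (y k))"
    and "(\<Sum>i\<in>I. \<Sum>k\<in>I. \<theta> (x i) (x k) (m (y i) (y k))) = (\<Sum>i\<in>I. \<Sum>k\<in>I. \<theta> (y i) (y k) (m (x i) (x k)))"
    and "(\<Sum>i\<in>I. \<Sum>k\<in>I. \<theta> (x i) (x k) (m (y k) (y i))) = (\<Sum>i\<in>I. \<Sum>k\<in>I. \<theta> (y i) (y k) (m (x k) (x i)))"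
proof -
  interpret W: vector_space sW using multilinear by simp
  \<comment> \<open>\<open>swap\<close>, \<open>swap'\<close> and \<open>swap''\<close> exchange the
    entries of the first copy of \<open>r\<close>, of the second, and of both; \<open>H\<close>
    takes the two entries of the first copy before those of the second.\<close>
  have swap: "(\<Sum>i\<in>I. \<Sum>k\<in>I. H (y i) (x i) (x k) (y k)) = (\<Sum>i\<in>I. \<Sum>k\<in>I. H (x i) (y i) (x k) (y k))"
    if "\<And>u v. bilinear_map sA sA sW (\<lambda>a b. H a b u v)" for H :: "'a \<Rightarrow> 'a \<Rightarrow> 'a \<Rightarrow> 'a \<Rightarrow> 'w"
  proof -
    have "bilinear_map sA sA sW (\<lambda>a b. \<Sum>k\<in>I. H a b (x k) (y k))"
      using that multilinear by (auto simp: bilinear_map_alt sum.distrib W.scale_sum_right)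
    from sum_swap[OF this] show ?thesis .
  qed
  have swap': "(\<Sum>i\<in>I. \<Sum>k\<in>I. H (x i) (y i) (y k) (x k)) = (\<Sum>i\<in>I. \<Sum>k\<in>I. H (x i) (y i) (x k) (y k))"
    if "\<And>u v. bilinear_map sA sA sW (H u v)" for H :: "'a \<Rightarrow> 'a \<Rightarrow> 'a \<Rightarrow> 'a \<Rightarrow> 'w"
    by (rule sum.cong[OF refl], rule sum_swap, rule that)
  have swap'': "(\<Sum>i\<in>I. \<Sum>k\<in>I. H (y i) (x i) (y k) (x k)) = (\<Sum>i\<in>I. \<Sum>k\<in>I. H (x i) (y i) (x k) (y k))"
    if "\<And>u v. bilinear_map sA sA sW (H u v)" "\<And>u v. bilinear_map sA sA sW (\<lambda>a b. H a b u v)"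
    for H :: "'a \<Rightarrow> 'a \<Rightarrow> 'a \<Rightarrow> 'a \<Rightarrow> 'w"
    using swap[of "\<lambda>a b c d. H a b d c"] swap'[OF that(1)] that(2) by simp
  note bl = bilinear_map_alt
  show "(\<Sum>i\<in>I. \<Sum>k\<in>I. \<theta> (m (x i) (y k)) (x k) (y i)) = (\<Sum>i\<in>I. \<Sum>k\<in>I. \<theta> (m (x k) (x i)) (y i) (y k))"
    by (subst swap'[of "\<lambda>a b c d. \<theta> (m a c) d b"], use multilinear in \<open>simp add: bl\<close>) (rule sum.swap)
  show "(\<Sum>i\<in>I. \<Sum>k\<in>I. \<theta> (m (y i) (x k)) (x i) (y k)) = (\<Sum>i\<in>I. \<Sum>k\<in>I. \<theta> (m (x i) (x k)) (y i) (y k))"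
    by (rule swap[of "\<lambda>a b c d. \<theta> (m a c) b d"]) (use multilinear in \<open>simp add: bl\<close>)
  show "(\<Sum>i\<in>I. \<Sum>k\<in>I. \<theta> (x i) (m (y i) (x k)) (y k)) = (\<Sum>i\<in>I. \<Sum>k\<in>I. \<theta> (y i) (m (x i) (x k)) (y k))"
    by (rule swap[of "\<lambda>a b c d. \<theta> b (m a c) d"]) (use multilinear in \<open>simp add: bl\<close>)
  show "(\<Sum>i\<in>I. \<Sum>k\<in>I. \<theta> (x i) (m (x k) (y i)) (y k)) = (\<Sum>i\<in>I. \<Sum>k\<in>I. \<theta> (y i) (m (x k) (x i)) (y k))"
    by (rule swap[of "\<lambda>a b c d. \<theta> b (m c a) d"]) (use multilinear in \<open>simp add: bl\<close>)
  show "(\<Sum>i\<in>I. \<Sum>k\<in>I. \<theta> (x i) (x k) (m (y i) (y k))) = (\<Sum>i\<in>I. \<Sum>k\<in>I. \<theta> (y i) (y k) (m (x i) (x k)))"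
    by (rule swap''[of "\<lambda>a b c d. \<theta> b d (m a c)"]) (use multilinear in \<open>simp_all add: bl\<close>)
  show "(\<Sum>i\<in>I. \<Sum>k\<in>I. \<theta> (x i) (x k) (m (y k) (y i))) = (\<Sum>i\<in>I. \<Sum>k\<in>I. \<theta> (y i) (y k) (m (x k) (x i)))"
    by (rule swap''[of "\<lambda>a b c d. \<theta> b d (m c a)"]) (use multilinear in \<open>simp_all add: bl\<close>)
qed

context
  fixes sAAA :: "'k \<Rightarrow> 'aaa::ab_group_add \<Rightarrow> 'aaa" and tAAA
  assumes AAA: "tensor_product sAA sA sAAA tAAA"
begin

lemma lift_tensor_cube:
  assumes L: "Vector_Spaces.linear sAAA sW L" "\<And>u v w. L (tAAA (tAA u v) w) = \<theta> u v w"
    and F: "\<And>x y. bilinear_map sA sA sAAA (F x y)" "\<And>x' y'. bilinear_map sA sA sAAA (\<lambda>x y. F x y x' y')"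
  shows "L (tensor_lift2 sAA sAAA tAA F r r) = (\<Sum>i\<in>I. \<Sum>k\<in>I. L (F (x i) (y i) (x k) (y k)))"
proof -
  interpret L: Vector_Spaces.linear sAAA sW L by fact
  show ?thesis using AA.tensor_lift2_sum[OF F, of x y I x y I] by (simp add: r L.sum)
qed

text \<open>The linear map \<open>L\<close> induced by \<theta> sends the eight terms to standard
  sums. By symmetry of \<open>r\<close>, \<open>S1\<close> agrees with \<open>S7\<close> and
  \<open>S2\<close> with \<open>S6\<close>; these pairs carry opposite signs in both equations, so
  four terms survive in each.\<close>

lemma ppybe_cube_sums:
  shows "ppybe_Z sAA sAAA tAA tAAA m r = 0 \<Longrightarrow>
      (\<Sum>i\<in>I. \<Sum>k\<in>I. \<theta> (y i) (y k) (m (x i) (x k))) + (\<Sum>i\<in>I. \<Sum>k\<in>I. \<theta> (y i) (y k) (m (x k) (x i)))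
    = (\<Sum>i\<in>I. \<Sum>k\<in>I. \<theta> (y i) (m (x i) (x k)) (y k)) + (\<Sum>i\<in>I. \<Sum>k\<in>I. \<theta> (m (x i) (x k)) (y i) (y k))"
    (is "?Z \<Longrightarrow> ?a3 + ?a3' = ?a2 + ?a1")
  and "ppybe_PL sAA sAAA tAA tAAA m r = 0 \<Longrightarrow>
      (\<Sum>i\<in>I. \<Sum>k\<in>I. \<theta> (m (x i) (x k)) (y i) (y k)) + (\<Sum>i\<in>I. \<Sum>k\<in>I. \<theta> (y i) (y k) (m (x k) (x i)))
    = (\<Sum>i\<in>I. \<Sum>k\<in>I. \<theta> (y i) (m (x i) (x k)) (y k)) + (\<Sum>i\<in>I. \<Sum>k\<in>I. \<theta> (y i) (y k) (m (x i) (x k)))"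
    (is "?PL \<Longrightarrow> _")
proof -
  interpret AAA: tensor_product sAA sA sAAA tAAA by (rule AAA)
  obtain L where L: "Vector_Spaces.linear sAAA sW L" "\<And>u v w. L (tAAA (tAA u v) w) = \<theta> u v w"
    using trilinear_factors_through_tensor[OF AA.tensor_product_axioms AAA \<theta>] by blast
  interpret L: Vector_Spaces.linear sAAA sW L by fact
  note ml = AA.bilinear_tens[unfolded bilinear_map_alt] AAA.bilinear_tens[unfolded bilinear_map_alt]
    m[unfolded bilinear_map_alt]
  define S where "S F = tensor_lift2 sAA sAAA tAA F r r" for F
  \<comment> \<open>\<open>S1\<close> to \<open>S8\<close> follow the order in which the definitions
    name the terms; \<open>sum.swap\<close> is used where the two copies of \<open>r\<close> have to
    be interchanged.\<close>
  have S1: "L (S (\<lambda>x y x' y'. tAAA (tAA (m x x') y') y)) = (\<Sum>i\<in>I. \<Sum>k\<in>I. \<theta> (m (x k) (x i)) (y i) (y k))"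
    unfolding S_def by (subst lift_tensor_cube[OF L], use ml in \<open>simp_all add: bilinear_map_alt\<close>)
      (simp add: L(2), rule sum.swap)
  have S2: "L (S (\<lambda>x y x' y'. tAAA (tAA y' (m x x')) y)) = (\<Sum>i\<in>I. \<Sum>k\<in>I. \<theta> (y i) (m (x k) (x i)) (y k))"
    unfolding S_def by (subst lift_tensor_cube[OF L], use ml in \<open>simp_all add: bilinear_map_alt\<close>)
      (simp add: L(2), rule sum.swap)
  have S3: "L (S (\<lambda>x y x' y'. tAAA (tAA x x') (m y y'))) = ?a3"
    unfolding S_def by (subst lift_tensor_cube[OF L], use ml in \<open>simp_all add: bilinear_map_alt\<close>)
      (simp add: L(2) sums_normal_form)
  have S4: "L (S (\<lambda>x y x' y'. tAAA (tAA x' x) (m y y'))) = ?a3'"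
    unfolding S_def by (subst lift_tensor_cube[OF L], use ml in \<open>simp_all add: bilinear_map_alt\<close>)
      (subst sum.swap, simp add: L(2) sums_normal_form)
  have S5: "L (S (\<lambda>x y x' y'. tAAA (tAA x (m y x')) y')) = ?a2"
    unfolding S_def by (subst lift_tensor_cube[OF L], use ml in \<open>simp_all add: bilinear_map_alt\<close>)
      (simp add: L(2) sums_normal_form)
  have S6: "L (S (\<lambda>x y x' y'. tAAA (tAA x' (m x y')) y)) = (\<Sum>i\<in>I. \<Sum>k\<in>I. \<theta> (y i) (m (x k) (x i)) (y k))"
    unfolding S_def by (subst lift_tensor_cube[OF L], use ml in \<open>simp_all add: bilinear_map_alt\<close>)
      (subst sum.swap, simp add: L(2) sums_normal_form)
  have S7: "L (S (\<lambda>x y x' y'. tAAA (tAA (m x y') x') y)) = (\<Sum>i\<in>I. \<Sum>k\<in>I. \<theta> (m (x k) (x i)) (y i) (y k))"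
    unfolding S_def by (subst lift_tensor_cube[OF L], use ml in \<open>simp_all add: bilinear_map_alt\<close>)
      (simp add: L(2) sums_normal_form)
  have S8: "L (S (\<lambda>x y x' y'. tAAA (tAA (m y x') x) y')) = ?a1"
    unfolding S_def by (subst lift_tensor_cube[OF L], use ml in \<open>simp_all add: bilinear_map_alt\<close>)
      (simp add: L(2) sums_normal_form)
  note S = S1 S2 S3 S4 S5 S6 S7 S8
  show "?a3 + ?a3' = ?a2 + ?a1" if ?Z
  proof -
    have "L (ppybe_Z sAA sAAA tAA tAAA m r) = ?a3 + ?a3' - ?a2 - ?a1"
      unfolding ppybe_Z_def Let_def S_def[symmetric] by (simp add: L.add L.diff S)
    with that show ?thesis by (simp add: L.zero algebra_simps)
  qed
  show "?a1 + ?a3' = ?a2 + ?a3" if ?PL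
  proof -
    have "L (ppybe_PL sAA sAAA tAA tAAA m r) = ?a1 + ?a3' - ?a2 - ?a3"
      unfolding ppybe_PL_def Let_def S_def[symmetric] by (simp add: L.add L.diff S)
    with that show ?thesis by (simp add: L.zero algebra_simps)
  qed
qed

end
end
end

section \<open>Dual homogeneous bases of a quadratic graded perm algebra\<close>

text \<open>Duality identifies the coefficient at \<open>g j\<close> as
  \<open>\<beta> (h j) v\<close>, which the grading kills unless \<open>h j\<close> has the degree
  complementary to \<open>p\<close>. A general form \<beta> allows the use of \<omega> for
  \<open>e\<close> and of its transpose for \<open>f\<close>.\<close>

lemma homogeneous_dual_expansion:
  fixes sB :: "'k::field \<Rightarrow> 'b::ab_group_add \<Rightarrow> 'b" and m :: int
  assumes \<beta>: "bilinear_map sB sB (*) \<beta>"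
    and graded: "\<And>i j b b'. i + j + m \<noteq> 0 \<Longrightarrow> b \<in> G i \<Longrightarrow> b' \<in> G j \<Longrightarrow> \<beta> b b' = 0"
    and g: "inj_on g \<Omega>" "module.span sB (g ` \<Omega>) = UNIV"
    and hom: "\<And>j. j \<in> \<Omega> \<Longrightarrow> \<exists>d. h j \<in> G d"
    and dual: "\<And>i j. i \<in> \<Omega> \<Longrightarrow> j \<in> \<Omega> \<Longrightarrow> \<beta> (h i) (g j) = (if i = j then 1 else 0)"
    and fin: "finite {j \<in> \<Omega>. h j \<in> G (- m - p)}" and v: "v \<in> G p"
  shows "v = (\<Sum>j | j \<in> \<Omega> \<and> h j \<in> G (- m - p). sB (\<beta> (h j) v) (g j))"
proof -
  interpret vector_space sB using \<beta> by (simp add: bilinear_map_alt)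
  have "v \<in> module.span sB (g ` \<Omega>)" using g by simp
  then obtain T c where T: "finite T" "T \<subseteq> g ` \<Omega>" and v': "v = (\<Sum>b\<in>T. sB (c b) b)"
    unfolding span_explicit by blast
  define S where "S = {j \<in> \<Omega>. g j \<in> T}"
  have bij: "bij_betw g S T"
    using T g(1) by (auto simp: S_def bij_betw_def inj_on_def)
  then have finS: "finite S" using T bij_betw_finite by blast
  have v'': "v = (\<Sum>j\<in>S. sB (c (g j)) (g j))"
    using sum.reindex_bij_betw[OF bij, of "\<lambda>b. sB (c b) b"] v' by simp
  have \<beta>v: "\<beta> (h i) v = (if i \<in> S then c (g i) else 0)" if "i \<in> \<Omega>" for i
  proof -
    have "\<beta> (h i) v = (\<Sum>j\<in>S. c (g j) * \<beta> (h i) (g j))"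
      by (rule bilinear_map_expand_right[OF \<beta> v''])
    also have "\<dots> = (\<Sum>j\<in>S. if i = j then c (g j) else 0)"
      using that by (intro sum.cong) (auto simp: S_def dual)
    finally show ?thesis using finS by simp
  qed
  have 0: "\<beta> (h i) v = 0" if i: "i \<in> \<Omega>" "h i \<notin> G (- m - p)" for i
  proof -
    obtain d where d: "h i \<in> G d" using hom i by blast
    then have "d \<noteq> - m - p" using i by auto
    then show ?thesis using graded[of d p "h i" v] d v by simp
  qed
  let ?J = "{j \<in> \<Omega>. h j \<in> G (- m - p)}"
  \<comment> \<open>From the support \<open>S\<close> of a finite expansion to the degree set
    \<open>?J\<close>: indices of \<open>S\<close> outside \<open>?J\<close> drop out by the
    grading, and indices of \<open>?J\<close> outside \<open>S\<close> have coefficient zero by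
    \<open>\<beta>v\<close>.\<close>
  have "v = (\<Sum>j\<in>S. sB (\<beta> (h j) v) (g j))"
    unfolding v''[symmetric] by (subst v'', intro sum.cong refl) (simp add: \<beta>v S_def)
  also have "\<dots> = (\<Sum>j\<in>S \<inter> ?J. sB (\<beta> (h j) v) (g j))"
    by (rule sum.mono_neutral_right) (use finS 0 in \<open>auto simp: S_def\<close>)
  also have "\<dots> = (\<Sum>j\<in>?J. sB (\<beta> (h j) v) (g j))"
    by (rule sum.mono_neutral_left) (use fin in \<open>auto simp: \<beta>v\<close>)
  finally show ?thesis by simp
qed

locale dual_homogeneous_bases = quadratic_graded_perm_algebra sB perm G \<omega>
  for sB :: "'k::field \<Rightarrow> 'b::ab_group_add \<Rightarrow> 'b" and perm (infixl "\<diamondop>" 70) and G \<omega> +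
  fixes m :: int and \<Omega> :: "'j set" and e f :: "'j \<Rightarrow> 'b"
  assumes form_degree: "\<And>i j b b'. i + j + m \<noteq> 0 \<Longrightarrow> b \<in> G i \<Longrightarrow> b' \<in> G j \<Longrightarrow> \<omega> b b' = 0"
    and e: "homogeneous_basis sB G \<Omega> e"
    and f: "homogeneous_basis sB G \<Omega> f"
    and dual: "\<And>i j. i \<in> \<Omega> \<Longrightarrow> j \<in> \<Omega> \<Longrightarrow> \<omega> (f i) (e j) = (if i = j then 1 else 0)"
begin

section \<open>Degrees of the dual bases and expansions in them\<close>

definition J :: "int \<Rightarrow> 'j set" where "J p = {j \<in> \<Omega>. e j \<in> G p}"

text \<open>In any other degrees the form would pair \<open>f j\<close> with \<open>e j\<close> to
  zero, whereas duality gives one.\<close>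

lemma degree_dual: "j \<in> \<Omega> \<Longrightarrow> e j \<in> G p \<Longrightarrow> f j \<in> G q \<Longrightarrow> p + q + m = 0"
  using form_degree[of q p "f j" "e j"] dual[of j j] by (auto simp: algebra_simps)

text \<open>Both vectors are homogeneous of some degree, and by \<open>degree_dual\<close> each
  degree is determined by that of the partner.\<close>

lemma e_degree_iff: "j \<in> \<Omega> \<Longrightarrow> e j \<in> G p \<longleftrightarrow> f j \<in> G (- m - p)"
proof -
  assume j: "j \<in> \<Omega>"
  obtain d d' where d: "e j \<in> G d" "f j \<in> G d'"
    using j e f unfolding homogeneous_basis_def by blast
  have "p = d" if "e j \<in> G p"
    using degree_dual[OF j d] degree_dual[OF j that d(2)] by simp
  moreover have "- m - p = d'" if "f j \<in> G (- m - p)"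
    using degree_dual[OF j d] degree_dual[OF j d(1) that] by simp
  ultimately show ?thesis
    using d degree_dual[OF j d] by (metis add.commute diff_add_cancel diff_minus_eq_add eq_neg_iff_add_eq_0)
qed

lemma J_alt: "J p = {j \<in> \<Omega>. f j \<in> G (- m - p)}"
  using e_degree_iff by (auto simp: J_def)

text \<open>This confines the components of \<open>r_hat\<close> to the antidiagonal
  \<open>p + q + m = 0\<close>.\<close>

lemma bidegree_set: "{j. j \<in> \<Omega> \<and> e j \<in> G p \<and> f j \<in> G q} = (if p + q + m = 0 then J p else {})"
proof (cases "p + q + m = 0")
  case True
  then have q: "q = - m - p" by simp
  show ?thesis unfolding q using e_degree_iff by (auto simp: J_def)
qed (use degree_dual in auto)

lemma JD: "j \<in> J p \<Longrightarrow> j \<in> \<Omega>" "j \<in> J p \<Longrightarrow> e j \<in> G p" "j \<in> J p \<Longrightarrow> f j \<in> G (- m - p)"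
  using J_alt by (auto simp: J_def)

lemma finite_J: "finite (J p)"
proof -
  obtain S where S: "finite S" "span S = G p" using finite_dim_pieces by (auto simp: finite_dim_subspace_def)
  have "independent (e ` J p)" using e independent_mono[of "e ` \<Omega>" "e ` J p"] by (auto simp: homogeneous_basis_def J_def)
  moreover have "e ` J p \<subseteq> span S" using S by (auto simp: J_def)
  ultimately have "finite (e ` J p)" using independent_span_bound[OF S(1)] by blast
  moreover have "inj_on e (J p)" using e by (auto simp: homogeneous_basis_def J_def intro: inj_on_subset)
  ultimately show ?thesis by (simp add: finite_image_iff)
qed

lemma expand_e: "v \<in> G p \<Longrightarrow> v = (\<Sum>j\<in>J p. sB (\<omega> (f j) v) (e j))"
  using homogeneous_dual_expansion[where \<beta> = \<omega> and g = e and h = f and p = p and v = v, OF bilinear_form form_degree] e f dual finite_J[of p]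
  unfolding homogeneous_basis_def J_alt by simp

lemma expand_f: "v \<in> G (- m - p) \<Longrightarrow> v = (\<Sum>j\<in>J p. sB (\<omega> v (e j)) (f j))"
proof -
  assume v: "v \<in> G (- m - p)"
  have "bilinear_map sB sB (*) (\<lambda>u v. \<omega> v u)" using bilinear_form by (simp add: bilinear_map_alt)
  moreover have "\<omega> b' b = 0" if "i + j + m \<noteq> 0" "b \<in> G i" "b' \<in> G j" for i j b b'
    using form_degree[of j i b' b] that by (simp add: add.commute)
  moreover have "\<omega> (f j) (e i) = (if i = j then 1 else 0)" if "i \<in> \<Omega>" "j \<in> \<Omega>" for i j
    using dual[OF that(2,1)] by simp
  \<comment> \<open>For the transposed form the bases exchange roles, and the degree complementary
    to \<open>- m - p\<close> is \<open>p\<close> again.\<close>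
  ultimately have "v = (\<Sum>j | j \<in> \<Omega> \<and> e j \<in> G (- m - (- m - p)). sB (\<omega> v (e j)) (f j))"
    using e f finite_J[of p] v unfolding homogeneous_basis_def J_def
    by (intro homogeneous_dual_expansion[where \<beta> = "\<lambda>u v. \<omega> v u"]) auto
  then show ?thesis by (simp add: J_def)
qed

text \<open>Expanding each \<open>e l\<close> in the vectors \<open>f j\<close> of the same degree
  produces the coefficients \<open>\<omega> (e l) (e j)\<close>. Antisymmetry turns them into those
  of the expansion of \<open>e j\<close> in the vectors \<open>f l\<close>, at the cost of a
  sign.\<close>

lemma casimir_swap:
  assumes g: "bilinear_map sB sB sW g"
  shows "(\<Sum>j\<in>J (- m - p). g (e j) (f j)) = - (\<Sum>j\<in>J p. g (f j) (e j))"
proof -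
  interpret W: vector_space sW using g by (simp add: bilinear_map_alt)
  have "(\<Sum>l\<in>J (- m - p). g (e l) (f l)) = (\<Sum>l\<in>J (- m - p). \<Sum>j\<in>J p. sW (\<omega> (e l) (e j)) (g (f j) (f l)))"
    by (intro sum.cong refl bilinear_map_expand_left[OF g] expand_f JD)
  also have "\<dots> = (\<Sum>j\<in>J p. \<Sum>l\<in>J (- m - p). sW (\<omega> (e l) (e j)) (g (f j) (f l)))" by (rule sum.swap)
  also have "\<dots> = - (\<Sum>j\<in>J p. \<Sum>l\<in>J (- m - p). sW (\<omega> (e j) (e l)) (g (f j) (f l)))"
    unfolding sum_negf[symmetric]
    by (intro sum.cong refl, subst antisymmetric) (rule W.scale_minus_left)
  also have "\<dots> = - (\<Sum>j\<in>J p. g (f j) (e j))"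
  proof -
    have "g (f j) (e j) = (\<Sum>l\<in>J (- m - p). sW (\<omega> (e j) (e l)) (g (f j) (f l)))" if "j \<in> J p" for j
      by (rule bilinear_map_expand_right[OF g expand_f]) (simp add: JD(2)[OF that])
    then show ?thesis by simp
  qed
  finally show ?thesis .
qed

text \<open>Invariance and antisymmetry give \<open>\<omega> (u \<diamondop> v) w = \<omega> (w
  \<diamondop> v) u - \<omega> (v \<diamondop> w) u\<close>. The right side changes sign with
  \<open>v\<close> and \<open>w\<close> exchanged, and then reads as the cyclic identity.\<close>

lemma form_swap: "\<omega> (u \<diamondop> w) v = - \<omega> (u \<diamondop> v) w"
  and form_cyclic: "\<omega> (u \<diamondop> v) w + \<omega> (v \<diamondop> w) u + \<omega> (w \<diamondop> u) v = 0"
proof -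
  have *: "\<omega> (u \<diamondop> v) w = \<omega> (w \<diamondop> v) u - \<omega> (v \<diamondop> w) u" for u v w
  proof -
    have "\<omega> u (a - b) = \<omega> u a - \<omega> u b" for a b
      using bilinear_form bilinear_map_minus(2)[OF bilinear_form, of u b]
      unfolding bilinear_map_alt by (metis diff_conv_add_uminus)
    then show ?thesis using invariant[of u v w] antisymmetric[of u "v \<diamondop> w"] antisymmetric[of u "w \<diamondop> v"] by simp
  qed
  show **: "\<omega> (u \<diamondop> w) v = - \<omega> (u \<diamondop> v) w" for u v w
    using *[of u v w] *[of u w v] by simp
  show "\<omega> (u \<diamondop> v) w + \<omega> (v \<diamondop> w) u + \<omega> (w \<diamondop> u) v = 0"
    using *[of u v w] **[of w u v] by simp
qed

section \<open>Contractions of two Casimir elements\<close>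

context
  fixes sW :: "'k \<Rightarrow> 'w::ab_group_add \<Rightarrow> 'w" and \<psi> and p q :: int
  assumes \<psi>: "trilinear_map sB sB sB sW \<psi>"
begin

interpretation W: vector_space sW using \<psi> by (simp add: trilinear_map_alt)

text \<open>A common form for all contractions: the product is expanded in a basis and \<kappa>
  records its coefficients, so that identities between trilinear forms on \<open>B\<close> become
  identities between contractions.\<close>

definition "contract \<kappa> = (\<Sum>j\<in>J p. \<Sum>l\<in>J q. \<Sum>c\<in>J (p + q). sW (\<kappa> (f c) (e j) (e l)) (\<psi> (e c) (f j) (f l)))"

lemma contract_combine:
  shows contract_diff: "contract (\<lambda>u v w. \<kappa> u v w - \<kappa>' u v w) = contract \<kappa> - contract \<kappa>'"
    and contract_minus: "contract (\<lambda>u v w. - \<kappa> u v w) = - contract \<kappa>"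
  by (simp_all add: contract_def W.scale_left_diff_distrib sum_subtractf sum_negf)

lemma bilin: "bilinear_map sB sB sW (\<lambda>u v. \<psi> u v w)" "bilinear_map sB sB sW (\<lambda>v w. \<psi> u v w)"
  "bilinear_map sB sB sW (\<lambda>u w. \<psi> u v w)"
  using \<psi> unfolding trilinear_map_alt bilinear_map_alt by auto

text \<open>\<open>expand_e\<close> applies to the product in the first slot;
  \<open>contract_second\<close> and \<open>contract_third\<close> apply \<open>expand_f\<close> to
  the other slots, where the coefficients are paired with \<open>e\<close>.\<close>

lemma contract_first:
  assumes "\<And>j l. j \<in> J p \<Longrightarrow> l \<in> J q \<Longrightarrow> M (e j) (e l) \<in> G (p + q)"
  shows "(\<Sum>j\<in>J p. \<Sum>l\<in>J q. \<psi> (M (e j) (e l)) (f j) (f l)) = contract (\<lambda>u v w. \<omega> u (M v w))"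
  unfolding contract_def
proof (intro sum.cong refl)
  fix j l assume "j \<in> J p" "l \<in> J q"
  then show "\<psi> (M (e j) (e l)) (f j) (f l) =
      (\<Sum>c\<in>J (p + q). sW (\<omega> (f c) (M (e j) (e l))) (\<psi> (e c) (f j) (f l)))"
    by (intro bilinear_map_expand_left[OF bilin(1)] expand_e assms)
qed

lemma contract_second:
  assumes "\<And>c l. c \<in> J (p + q) \<Longrightarrow> l \<in> J q \<Longrightarrow> M (f c) (e l) \<in> G (- m - p)"
  shows "(\<Sum>c\<in>J (p + q). \<Sum>l\<in>J q. \<psi> (e c) (M (f c) (e l)) (f l)) = contract (\<lambda>u v w. \<omega> (M u w) v)"
proof -
  have "\<psi> (e c) (M (f c) (e l)) (f l) = (\<Sum>j\<in>J p. sW (\<omega> (M (f c) (e l)) (e j)) (\<psi> (e c) (f j) (f l)))"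
    if "c \<in> J (p + q)" "l \<in> J q" for c l
    by (intro bilinear_map_expand_right[OF bilin(1)] expand_f assms that)
  then have "(\<Sum>c\<in>J (p + q). \<Sum>l\<in>J q. \<psi> (e c) (M (f c) (e l)) (f l)) =
    (\<Sum>c\<in>J (p + q). \<Sum>l\<in>J q. \<Sum>j\<in>J p. sW (\<omega> (M (f c) (e l)) (e j)) (\<psi> (e c) (f j) (f l)))"
    by simp
  also have "\<dots> = (\<Sum>l\<in>J q. \<Sum>j\<in>J p. \<Sum>c\<in>J (p + q). sW (\<omega> (M (f c) (e l)) (e j)) (\<psi> (e c) (f j) (f l)))"
    by (subst sum.swap) (intro sum.cong refl sum.swap)
  also have "\<dots> = contract (\<lambda>u v w. \<omega> (M u w) v)"
    unfolding contract_def by (rule sum.swap)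
  finally show ?thesis .
qed

text \<open>Two vectors \<open>e\<close> stand outside the product, but \<open>contract\<close>
  needs an \<open>f\<close> in the second slot. \<open>casimir_swap\<close> exchanges the legs of
  that copy, which accounts for the minus sign and for the degree \<open>- m - p\<close>.\<close>

lemma contract_third:
  assumes M: "bilinear_map sB sB sB M" and deg: "\<And>c j. c \<in> J (p + q) \<Longrightarrow> j \<in> J p \<Longrightarrow> M (f c) (e j) \<in> G (- m - q)"
  shows "(\<Sum>c\<in>J (p + q). \<Sum>j\<in>J (- m - p). \<psi> (e c) (e j) (M (f c) (f j))) = - contract (\<lambda>u v w. \<omega> (M u v) w)"
proof -
  have "\<psi> (e c) (f j) (M (f c) (e j)) = (\<Sum>l\<in>J q. sW (\<omega> (M (f c) (e j)) (e l)) (\<psi> (e c) (f j) (f l)))"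
    if "c \<in> J (p + q)" "j \<in> J p" for c j
    by (intro bilinear_map_expand_right[OF bilin(2)] expand_f deg that)
  moreover have "(\<Sum>j\<in>J (- m - p). \<psi> (e c) (e j) (M (f c) (f j))) = - (\<Sum>j\<in>J p. \<psi> (e c) (f j) (M (f c) (e j)))" for c
    by (rule casimir_swap[of sW "\<lambda>u v. \<psi> (e c) u (M (f c) v)"])
      (use M \<psi> in \<open>simp add: bilinear_map_alt trilinear_map_alt\<close>)
  ultimately have "(\<Sum>c\<in>J (p + q). \<Sum>j\<in>J (- m - p). \<psi> (e c) (e j) (M (f c) (f j))) =
    - (\<Sum>c\<in>J (p + q). \<Sum>j\<in>J p. \<Sum>l\<in>J q. sW (\<omega> (M (f c) (e j)) (e l)) (\<psi> (e c) (f j) (f l)))"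
    by (simp add: sum_negf)
  also have "\<dots> = - (\<Sum>j\<in>J p. \<Sum>c\<in>J (p + q). \<Sum>l\<in>J q. sW (\<omega> (M (f c) (e j)) (e l)) (\<psi> (e c) (f j) (f l)))"
    by (subst sum.swap) simp
  also have "\<dots> = - contract (\<lambda>u v w. \<omega> (M u v) w)"
    unfolding contract_def by (intro arg_cong[of _ _ uminus] sum.cong refl sum.swap)
  finally show ?thesis .
qed

definition "E1 = (\<Sum>j\<in>J p. \<Sum>l\<in>J q. \<psi> (e j \<diamondop> e l) (f j) (f l))"
definition "E2 = (\<Sum>j\<in>J p. \<Sum>l\<in>J q. \<psi> (e l \<diamondop> e j) (f j) (f l))"

lemma E_contract:
  shows "E1 = contract (\<lambda>u v w. \<omega> u (v \<diamondop> w))" and "E2 = contract (\<lambda>u v w. \<omega> u (w \<diamondop> v))"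
  unfolding E1_def E2_def
  using contract_first[of "(\<diamondop>)"] contract_first[of "\<lambda>u v. v \<diamondop> u"]
    graded_perm[OF JD(2) JD(2), of _ p _ q] graded_perm[OF JD(2) JD(2), of _ q _ p]
  by (simp_all only: add.commute[of q p])

text \<open>By \<open>form_swap\<close>, \<open>E1\<close> belongs to
  \<open>- \<omega> (v \<diamondop> w) u\<close> and \<open>E2\<close> to
  \<open>\<omega> (w \<diamondop> u) v\<close>; the cyclic identity then assigns
  \<open>- \<omega> (u \<diamondop> v) w\<close> to \<open>E2 - E1\<close>. The four sums give these
  forms up to \<open>form_swap\<close>.\<close>

lemma contractions:
  shows "(\<Sum>c\<in>J (p + q). \<Sum>j\<in>J (- m - p). \<psi> (e c) (e j) (f c \<diamondop> f j)) = E2 - E1" (is "?A = _")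
    and "(\<Sum>c\<in>J (p + q). \<Sum>j\<in>J (- m - p). \<psi> (e c) (e j) (f j \<diamondop> f c)) = - E1" (is "?B = _")
    and "(\<Sum>c\<in>J (p + q). \<Sum>l\<in>J q. \<psi> (e c) (e l \<diamondop> f c) (f l)) = E2" (is "?C = _")
    and "(\<Sum>c\<in>J (p + q). \<Sum>l\<in>J q. \<psi> (e c) (f c \<diamondop> e l) (f l)) = E2 - E1" (is "?D = _")
proof -
  have flip: "bilinear_map sB sB sB (\<lambda>u v. v \<diamondop> u)" using bilinear_perm by (simp add: bilinear_map_alt)
  have deg: "f c \<diamondop> e l \<in> G d" "e l \<diamondop> f c \<in> G d" if "c \<in> J s" "l \<in> J t" "d = - m - s + t" for c l s t d
    using graded_perm[OF JD(3)[OF that(1)] JD(2)[OF that(2)]] graded_perm[OF JD(2)[OF that(2)] JD(3)[OF that(1)]]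
    unfolding that(3) by (simp_all only: add.commute)
  have E1: "E1 = contract (\<lambda>u v w. - \<omega> (v \<diamondop> w) u)" and E2: "E2 = contract (\<lambda>u v w. \<omega> (w \<diamondop> u) v)"
  proof -
    have "\<omega> u (v \<diamondop> w) = - \<omega> (v \<diamondop> w) u" "\<omega> u (w \<diamondop> v) = \<omega> (w \<diamondop> u) v" for u v w
      using antisymmetric[of u "v \<diamondop> w"] antisymmetric[of u "w \<diamondop> v"] form_swap[of w u v] by simp_all
    then show "E1 = contract (\<lambda>u v w. - \<omega> (v \<diamondop> w) u)" "E2 = contract (\<lambda>u v w. \<omega> (w \<diamondop> u) v)"
      unfolding E_contract by (intro arg_cong[of _ _ contract] ext, blast)+
  qed
  have E21: "E2 - E1 = contract (\<lambda>u v w. - \<omega> (u \<diamondop> v) w)"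
    unfolding E1 E2 contract_diff[symmetric]
  proof (intro arg_cong[of _ _ contract] ext)
    fix u v w
    show "\<omega> (w \<diamondop> u) v - - \<omega> (v \<diamondop> w) u = - \<omega> (u \<diamondop> v) w"
      using form_cyclic[of u v w] by (simp add: eq_neg_iff_add_eq_0 ac_simps)
  qed
  have "?A = - contract (\<lambda>u v w. \<omega> (u \<diamondop> v) w)"
    by (rule contract_third[OF bilinear_perm]) (auto intro: deg)
  then show "?A = E2 - E1" by (simp add: E21 contract_minus)
  have "?B = - contract (\<lambda>u v w. \<omega> (v \<diamondop> u) w)"
    by (rule contract_third[OF flip]) (auto intro: deg)
  also have "\<dots> = - E1"
    unfolding E1 by (intro arg_cong[of _ _ "\<lambda>\<kappa>. - contract \<kappa>"] ext form_swap)
  finally show "?B = - E1" .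
  show "?C = E2"
    unfolding E2 by (rule contract_second[of "\<lambda>u v. v \<diamondop> u"]) (auto intro: deg)
  have "?D = contract (\<lambda>u v w. \<omega> (u \<diamondop> w) v)"
    by (rule contract_second) (auto intro: deg)
  also have "\<dots> = E2 - E1"
    unfolding E21 by (intro arg_cong[of _ _ contract] ext form_swap)
  finally show "?D = E2 - E1" .
qed

end

end

section \<open>The induced solution\<close>

locale induced_tensor =
  B: dual_homogeneous_bases sB perm G \<omega> m \<Omega> e f +
  P: tensor_product sA sB sP tP +
  PP: tensor_product sP sP sPP tPP +
  PPP: tensor_product sPP sP sPPP tPPP
  for sA :: "'k::field \<Rightarrow> 'a::ab_group_add \<Rightarrow> 'a"
    and sB :: "'k \<Rightarrow> 'b::ab_group_add \<Rightarrow> 'b"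
    and sP :: "'k \<Rightarrow> 'p::ab_group_add \<Rightarrow> 'p"
    and sPP :: "'k \<Rightarrow> 'pp::ab_group_add \<Rightarrow> 'pp"
    and sPPP :: "'k \<Rightarrow> 'ppp::ab_group_add \<Rightarrow> 'ppp"
    and perm :: "'b \<Rightarrow> 'b \<Rightarrow> 'b" (infixl "\<diamondop>" 70) and G \<omega> m
    and \<Omega> :: "'j set" and e f
    and tP :: "'a \<Rightarrow> 'b \<Rightarrow> 'p" and tPP :: "'p \<Rightarrow> 'p \<Rightarrow> 'pp" and tPPP :: "'pp \<Rightarrow> 'p \<Rightarrow> 'ppp" +
  fixes I :: "'i set" and x y :: "'i \<Rightarrow> 'a"
begin

definition "T u v w = tPPP (tPP u v) w"

abbreviation "rh \<equiv> r_hat tPP tP G I x y \<Omega> e f"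

lemma trilinear_T: "trilinear_map sP sP sP sPPP T"
  using PP.bilinear_tens PPP.bilinear_tens by (simp add: trilinear_map_alt bilinear_map_alt T_def)

text \<open>A single sum over pairs has the shape required by \<open>tensor_lift_sum\<close> and
  \<open>tensor_lift2_sum\<close>.\<close>

lemma r_hat_eq:
  "rh p q = (if p + q + m = 0 then
     (\<Sum>z\<in>I \<times> B.J p. tPP (tP (x (fst z)) (e (snd z))) (tP (y (fst z)) (f (snd z)))) else 0)"
  unfolding r_hat_def B.bidegree_set by (simp add: sum.cartesian_product case_prod_unfold)

lemma r_hat_in_completed: "rh \<in> completed_tensor_square sPP tPP (induced_grading sP tP G)"
proof -
  have "tP a b \<in> induced_grading sP tP G p" if "b \<in> G p" for a b p
    using that by (auto simp: induced_grading_def tensor_subspace_def intro: P.T.span_base)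
  then have "tPP (tP a b) (tP a' b') \<in> tensor_subspace sPP tPP (induced_grading sP tP G p) (induced_grading sP tP G q)"
    if "b \<in> G p" "b' \<in> G q" for a b a' b' p q
    unfolding tensor_subspace_def using that by (intro PP.T.span_base) blast
  then show ?thesis
    by (auto simp: completed_tensor_square_def r_hat_def tensor_subspace_def intro!: PP.T.span_sum)
qed

text \<open>A nonzero \<open>rh i j\<close> forces \<open>j = - m - i\<close>, so a contributing
  quadruple is determined by \<open>i\<close> and \<open>k\<close>, and \<open>uniq\<close> leaves
  one candidate. Each completed sum thus has at most one term in every degree.\<close>

lemma completed_sum_at:
  assumes F: "\<And>x y. bilinear_map sP sP sPPP (F x y)" "\<And>x' y'. bilinear_map sP sP sPPP (\<lambda>x y. F x y x' y')"
    and uniq: "\<And>i k. d i (- m - i) k (- m - k) = n \<Longrightarrow> i = i0 \<and> k = k0"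
  shows "finite (contributing_degrees sPP sPPP tPP d F rh n)"
    and "d i0 (- m - i0) k0 (- m - k0) = n \<Longrightarrow> completed_sum sPP sPPP tPP d F rh n =
      (\<Sum>i\<in>I. \<Sum>k\<in>I. \<Sum>j\<in>B.J i0. \<Sum>l\<in>B.J k0.
        F (tP (x i) (e j)) (tP (y i) (f j)) (tP (x k) (e l)) (tP (y k) (f l)))"
    and "d i0 (- m - i0) k0 (- m - k0) \<noteq> n \<Longrightarrow> completed_sum sPP sPPP tPP d F rh n = 0"
proof -
  let ?t = "tensor_lift2 sPP sPPP tPP F"
  let ?C = "contributing_degrees sPP sPPP tPP d F rh n"
  let ?q = "(i0, - m - i0, k0, - m - k0)"
  note zero = bilinear_map_zero[OF PP.bilinear_tensor_lift2[OF F]]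
  have dual_degree: "j = - m - i" if "rh i j \<noteq> 0" for i j
    using that by (auto simp: r_hat_eq split: if_splits)
  have nonzero: "rh i j \<noteq> 0 \<and> rh k l \<noteq> 0" if "?t (rh i j) (rh k l) \<noteq> 0" for i j k l
    using that zero by metis
  have C: "d i0 (- m - i0) k0 (- m - k0) = n \<and> z = ?q" if "z \<in> ?C" for z
  proof -
    obtain i j k l where z: "z = (i, j, k, l)" by (cases z)
    then have d: "d i j k l = n" and "?t (rh i j) (rh k l) \<noteq> 0"
      using that by (auto simp: contributing_degrees_def)
    then have "j = - m - i" "l = - m - k" using nonzero dual_degree by blast+
    with d uniq[of i k] z show ?thesis by simp
  qed
  then have sub: "?C \<subseteq> {?q}" by blast
  then show "finite ?C" by (rule finite_subset) simp
  show "completed_sum sPP sPPP tPP d F rh n = 0" if "d i0 (- m - i0) k0 (- m - k0) \<noteq> n"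
  proof -
    have "?C = {}" using C that by blast
    then show ?thesis by (simp add: completed_sum_def)
  qed
  assume n: "d i0 (- m - i0) k0 (- m - k0) = n"
  \<comment> \<open>If the term at \<open>?q\<close> is zero, no quadruple contributes; the sum over
    the singleton is then zero as well.\<close>
  have "completed_sum sPP sPPP tPP d F rh n = (\<Sum>(i, j, k, l)\<in>{?q}. ?t (rh i j) (rh k l))"
    unfolding completed_sum_def
    by (rule sum.mono_neutral_left) (use sub n in \<open>auto simp: contributing_degrees_def\<close>)
  also have "\<dots> = ?t (rh i0 (- m - i0)) (rh k0 (- m - k0))" by simp
  also have "\<dots> = (\<Sum>z\<in>I \<times> B.J i0. \<Sum>z'\<in>I \<times> B.J k0. F (tP (x (fst z)) (e (snd z)))
      (tP (y (fst z)) (f (snd z))) (tP (x (fst z')) (e (snd z'))) (tP (y (fst z')) (f (snd z'))))"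
    by (simp add: r_hat_eq PP.tensor_lift2_sum[OF F])
  also have "\<dots> = (\<Sum>i\<in>I. \<Sum>j\<in>B.J i0. \<Sum>k\<in>I. \<Sum>l\<in>B.J k0.
        F (tP (x i) (e j)) (tP (y i) (f j)) (tP (x k) (e l)) (tP (y k) (f l)))"
    by (simp add: sum.cartesian_product')
  also have "\<dots> = (\<Sum>i\<in>I. \<Sum>k\<in>I. \<Sum>j\<in>B.J i0. \<Sum>l\<in>B.J k0.
        F (tP (x i) (e j)) (tP (y i) (f j)) (tP (x k) (e l)) (tP (y k) (f l)))"
    by (intro sum.cong refl sum.swap)
  finally show "completed_sum sPP sPPP tPP d F rh n = \<dots>" .
qed

text \<open>With the entries from \<open>A\<close> fixed, the tensor is trilinear on
  \<open>B\<close> and can be contracted; the result, as a function of these entries, is trilinear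
  on \<open>A\<close> and serves to test the pre-Poisson equation.\<close>

definition "E1 p q u v w = B.E1 (\<lambda>b b' b''. T (tP u b) (tP v b') (tP w b'')) p q"
definition "E2 p q u v w = B.E2 (\<lambda>b b' b''. T (tP u b) (tP v b') (tP w b'')) p q"

lemma trilinear_B: "trilinear_map sB sB sB sPPP (\<lambda>b b' b''. T (tP u b) (tP v b') (tP w b''))"
  and trilinear_A: "trilinear_map sA sA sA sPPP (\<lambda>u v w. T (tP u b) (tP v b') (tP w b''))"
  using trilinear_T P.bilinear_tens by (simp_all add: trilinear_map_alt bilinear_map_alt)

lemma trilinear_E: "trilinear_map sA sA sA sPPP (E1 p q)" "trilinear_map sA sA sA sPPP (E2 p q)"
  unfolding E1_def E2_def B.E1_def[OF trilinear_B] B.E2_def[OF trilinear_B]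
  by (intro trilinear_map_sum trilinear_A)+

lemmas contractions = B.contractions[OF trilinear_B, folded E1_def E2_def]

section \<open>The completed products of two copies of the lifted tensor\<close>

context
  fixes \<mu> \<nu> :: "'a \<Rightarrow> 'a \<Rightarrow> 'a"
  assumes \<mu>: "bilinear_map sA sA sA \<mu>" and \<nu>: "bilinear_map sA sA sA \<nu>"
begin

text \<open>Two parameters treat both operations at once: \<mu> = \<nu> = \<open>zin\<close> gives
  the product, \<mu> = \<open>pre\<close> and \<nu> = \<open>- pre\<close> the bracket.\<close>

definition "op = tensor_lift2 sP sP tP (\<lambda>a b a' b'. tP (\<mu> a a') (b \<diamondop> b') + tP (\<nu> a' a) (b' \<diamondop> b))"

lemma bilinear_op: "bilinear_map sP sP sP op"
  and op_tens: "op (tP a b) (tP a' b') = tP (\<mu> a a') (b \<diamondop> b') + tP (\<nu> a' a) (b' \<diamondop> b)"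
proof -
  let ?F = "\<lambda>a b a' b'. tP (\<mu> a a') (b \<diamondop> b') + tP (\<nu> a' a) (b' \<diamondop> b)"
  note ml = \<mu>[unfolded bilinear_map_alt] \<nu>[unfolded bilinear_map_alt]
    B.bilinear_perm[unfolded bilinear_map_alt] P.bilinear_tens[unfolded bilinear_map_alt]
  have F: "bilinear_map sA sB sP (?F a b)" "bilinear_map sA sB sP (\<lambda>a b. ?F a b a' b')" for a b a' b'
    using ml by (simp_all add: bilinear_map_alt P.T.scale_right_distrib)
  show "bilinear_map sP sP sP op" unfolding op_def by (rule P.bilinear_tensor_lift2[OF F])
  show "op (tP a b) (tP a' b') = ?F a b a' b'"
    \<comment> \<open>One-element index sets turn the formula for sums into the value on pure
      tensors.\<close>
    using P.tensor_lift2_sum[OF F, of "\<lambda>_. a" "\<lambda>_. b" "{()}" "\<lambda>_. a'" "\<lambda>_. b'" "{()}"]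
    by (simp add: op_def)
qed

lemmas T_linear = trilinear_T[unfolded trilinear_map_alt] bilinear_op[unfolded bilinear_map_alt]

lemma T_add: "T (u + u') v w = T u v w + T u' v w" "T u (v + v') w = T u v w + T u v' w"
  "T u v (w + w') = T u v w + T u v w'"
  using T_linear by simp_all

text \<open>Terms of \<open>rh\<close> have total degree \<open>- m\<close>, so only output degrees
  of total \<open>- 2 * m\<close> occur; these are written \<open>(p + q, - m - p, - m - q)\<close>.
  Here the two \<open>e\<close> entries are multiplied, which is the shape of \<open>E1\<close> and
  \<open>E2\<close> themselves.\<close>

lemma r12_r13:
  defines "F \<equiv> \<lambda>x y x' y'. T (op x x') y y'" and "d \<equiv> \<lambda>i j k l. (i + k, j, l)"
  shows "completed_exists sPP sPPP tPP d F rh"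
    and "completed_sum sPP sPPP tPP d F rh (p + q, - m - p, - m - q) =
      (\<Sum>i\<in>I. \<Sum>k\<in>I. E1 p q (\<mu> (x i) (x k)) (y i) (y k)) + (\<Sum>i\<in>I. \<Sum>k\<in>I. E2 p q (\<nu> (x k) (x i)) (y i) (y k))"
    and "a + b + c + 2 * m \<noteq> 0 \<Longrightarrow> completed_sum sPP sPPP tPP d F rh (a, b, c) = 0"
proof -
  have F: "bilinear_map sP sP sPPP (F x y)" "bilinear_map sP sP sPPP (\<lambda>x y. F x y x' y')" for x y x' y'
    unfolding F_def using T_linear by (simp_all add: bilinear_map_alt)
  have *: "d i (- m - i) k (- m - k) = (a, b, c) \<Longrightarrow> i = - m - b \<and> k = - m - c" for i k a b c
    by (auto simp: d_def)
  show "completed_exists sPP sPPP tPP d F rh"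
    unfolding completed_exists_def using completed_sum_at(1)[OF F *] by auto
  show "completed_sum sPP sPPP tPP d F rh (a, b, c) = 0" if "a + b + c + 2 * m \<noteq> 0"
    by (rule completed_sum_at(3)[OF F *]) (use that in \<open>auto simp: d_def\<close>)
  have "completed_sum sPP sPPP tPP d F rh (p + q, - m - p, - m - q) = (\<Sum>i\<in>I. \<Sum>k\<in>I. \<Sum>j\<in>B.J p. \<Sum>l\<in>B.J q.
        F (tP (x i) (e j)) (tP (y i) (f j)) (tP (x k) (e l)) (tP (y k) (f l)))"
    by (rule completed_sum_at(2)[OF F]) (auto simp: d_def)
  then show "completed_sum sPP sPPP tPP d F rh (p + q, - m - p, - m - q) =
      (\<Sum>i\<in>I. \<Sum>k\<in>I. E1 p q (\<mu> (x i) (x k)) (y i) (y k)) + (\<Sum>i\<in>I. \<Sum>k\<in>I. E2 p q (\<nu> (x k) (x i)) (y i) (y k))"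
    by (simp add: F_def op_tens T_add sum.distrib E1_def E2_def B.E1_def[OF trilinear_B] B.E2_def[OF trilinear_B])
qed

text \<open>The \<open>f\<close> entries are multiplied and both \<open>e\<close> entries remain;
  the output degree puts the two copies in degrees \<open>p + q\<close> and \<open>- m - p\<close>,
  as in the first two identities of \<open>contractions\<close>.\<close>

lemma r13_r23:
  defines "F \<equiv> \<lambda>x y x' y'. T x x' (op y y')" and "d \<equiv> \<lambda>i j k l. (i, k, j + l)"
  shows "completed_exists sPP sPPP tPP d F rh"
    and "completed_sum sPP sPPP tPP d F rh (p + q, - m - p, - m - q) =
      (\<Sum>i\<in>I. \<Sum>k\<in>I. E2 p q (x i) (x k) (\<mu> (y i) (y k))) - (\<Sum>i\<in>I. \<Sum>k\<in>I. E1 p q (x i) (x k) (\<mu> (y i) (y k)))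
      - (\<Sum>i\<in>I. \<Sum>k\<in>I. E1 p q (x i) (x k) (\<nu> (y k) (y i)))"
    and "a + b + c + 2 * m \<noteq> 0 \<Longrightarrow> completed_sum sPP sPPP tPP d F rh (a, b, c) = 0"
proof -
  have F: "bilinear_map sP sP sPPP (F x y)" "bilinear_map sP sP sPPP (\<lambda>x y. F x y x' y')" for x y x' y'
    unfolding F_def using T_linear by (simp_all add: bilinear_map_alt)
  have *: "d i (- m - i) k (- m - k) = (a, b, c) \<Longrightarrow> i = a \<and> k = b" for i k a b c
    by (auto simp: d_def)
  show "completed_exists sPP sPPP tPP d F rh"
    unfolding completed_exists_def using completed_sum_at(1)[OF F *] by auto
  show "completed_sum sPP sPPP tPP d F rh (a, b, c) = 0" if "a + b + c + 2 * m \<noteq> 0"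
    by (rule completed_sum_at(3)[OF F *]) (use that in \<open>auto simp: d_def\<close>)
  have "completed_sum sPP sPPP tPP d F rh (p + q, - m - p, - m - q) = (\<Sum>i\<in>I. \<Sum>k\<in>I. \<Sum>j\<in>B.J (p + q). \<Sum>l\<in>B.J (- m - p).
        F (tP (x i) (e j)) (tP (y i) (f j)) (tP (x k) (e l)) (tP (y k) (f l)))"
    by (rule completed_sum_at(2)[OF F]) (auto simp: d_def)
  then show "completed_sum sPP sPPP tPP d F rh (p + q, - m - p, - m - q) =
      (\<Sum>i\<in>I. \<Sum>k\<in>I. E2 p q (x i) (x k) (\<mu> (y i) (y k))) - (\<Sum>i\<in>I. \<Sum>k\<in>I. E1 p q (x i) (x k) (\<mu> (y i) (y k)))
      - (\<Sum>i\<in>I. \<Sum>k\<in>I. E1 p q (x i) (x k) (\<nu> (y k) (y i)))"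
    by (simp add: F_def op_tens T_add sum.distrib contractions sum_subtractf sum_negf)
qed

lemma r23_r12:
  defines "F \<equiv> \<lambda>x y x' y'. T x' (op x y') y" and "d \<equiv> \<lambda>i j k l. (k, i + l, j)"
  shows "completed_exists sPP sPPP tPP d F rh"
    and "completed_sum sPP sPPP tPP d F rh (p + q, - m - p, - m - q) =
      (\<Sum>i\<in>I. \<Sum>k\<in>I. E2 p q (x i) (\<mu> (x k) (y i)) (y k)) + (\<Sum>i\<in>I. \<Sum>k\<in>I. E2 p q (x i) (\<nu> (y i) (x k)) (y k))
      - (\<Sum>i\<in>I. \<Sum>k\<in>I. E1 p q (x i) (\<nu> (y i) (x k)) (y k))"
    and "a + b + c + 2 * m \<noteq> 0 \<Longrightarrow> completed_sum sPP sPPP tPP d F rh (a, b, c) = 0"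
proof -
  have F: "bilinear_map sP sP sPPP (F x y)" "bilinear_map sP sP sPPP (\<lambda>x y. F x y x' y')" for x y x' y'
    unfolding F_def using T_linear by (simp_all add: bilinear_map_alt)
  have *: "d i (- m - i) k (- m - k) = (a, b, c) \<Longrightarrow> i = - m - c \<and> k = a" for i k a b c
    by (auto simp: d_def)
  show "completed_exists sPP sPPP tPP d F rh"
    unfolding completed_exists_def using completed_sum_at(1)[OF F *] by auto
  show "completed_sum sPP sPPP tPP d F rh (a, b, c) = 0" if "a + b + c + 2 * m \<noteq> 0"
    by (rule completed_sum_at(3)[OF F *]) (use that in \<open>auto simp: d_def\<close>)
  have "completed_sum sPP sPPP tPP d F rh (p + q, - m - p, - m - q) = (\<Sum>i\<in>I. \<Sum>k\<in>I. \<Sum>j\<in>B.J q. \<Sum>l\<in>B.J (p + q).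
        F (tP (x i) (e j)) (tP (y i) (f j)) (tP (x k) (e l)) (tP (y k) (f l)))"
    by (rule completed_sum_at(2)[OF F]) (auto simp: d_def)
  \<comment> \<open>Interchanging the two copies puts the one of degree \<open>p + q\<close> first,
    as \<open>contractions\<close> expects.\<close>
  also have "\<dots> = (\<Sum>i\<in>I. \<Sum>k\<in>I. \<Sum>l\<in>B.J (p + q). \<Sum>j\<in>B.J q.
        F (tP (x k) (e j)) (tP (y k) (f j)) (tP (x i) (e l)) (tP (y i) (f l)))"
    by (subst sum.swap) (intro sum.cong refl sum.swap)
  finally show "completed_sum sPP sPPP tPP d F rh (p + q, - m - p, - m - q) =
      (\<Sum>i\<in>I. \<Sum>k\<in>I. E2 p q (x i) (\<mu> (x k) (y i)) (y k)) + (\<Sum>i\<in>I. \<Sum>k\<in>I. E2 p q (x i) (\<nu> (y i) (x k)) (y k))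
      - (\<Sum>i\<in>I. \<Sum>k\<in>I. E1 p q (x i) (\<nu> (y i) (x k)) (y k))"
    by (simp add: F_def op_tens T_add sum.distrib contractions sum_subtractf)
qed

lemma r12_r23:
  defines "F \<equiv> \<lambda>x y x' y'. T x (op y x') y'" and "d \<equiv> \<lambda>i j k l. (i, j + k, l)"
  shows "completed_exists sPP sPPP tPP d F rh"
    and "completed_sum sPP sPPP tPP d F rh (p + q, - m - p, - m - q) =
      (\<Sum>i\<in>I. \<Sum>k\<in>I. E2 p q (x i) (\<mu> (y i) (x k)) (y k)) - (\<Sum>i\<in>I. \<Sum>k\<in>I. E1 p q (x i) (\<mu> (y i) (x k)) (y k))
      + (\<Sum>i\<in>I. \<Sum>k\<in>I. E2 p q (x i) (\<nu> (x k) (y i)) (y k))"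
    and "a + b + c + 2 * m \<noteq> 0 \<Longrightarrow> completed_sum sPP sPPP tPP d F rh (a, b, c) = 0"
proof -
  have F: "bilinear_map sP sP sPPP (F x y)" "bilinear_map sP sP sPPP (\<lambda>x y. F x y x' y')" for x y x' y'
    unfolding F_def using T_linear by (simp_all add: bilinear_map_alt)
  have *: "d i (- m - i) k (- m - k) = (a, b, c) \<Longrightarrow> i = a \<and> k = - m - c" for i k a b c
    by (auto simp: d_def)
  show "completed_exists sPP sPPP tPP d F rh"
    unfolding completed_exists_def using completed_sum_at(1)[OF F *] by auto
  show "completed_sum sPP sPPP tPP d F rh (a, b, c) = 0" if "a + b + c + 2 * m \<noteq> 0"
    by (rule completed_sum_at(3)[OF F *]) (use that in \<open>auto simp: d_def\<close>)
  have "completed_sum sPP sPPP tPP d F rh (p + q, - m - p, - m - q) = (\<Sum>i\<in>I. \<Sum>k\<in>I. \<Sum>j\<in>B.J (p + q). \<Sum>l\<in>B.J q.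
        F (tP (x i) (e j)) (tP (y i) (f j)) (tP (x k) (e l)) (tP (y k) (f l)))"
    by (rule completed_sum_at(2)[OF F]) (auto simp: d_def)
  then show "completed_sum sPP sPPP tPP d F rh (p + q, - m - p, - m - q) =
      (\<Sum>i\<in>I. \<Sum>k\<in>I. E2 p q (x i) (\<mu> (y i) (x k)) (y k)) - (\<Sum>i\<in>I. \<Sum>k\<in>I. E1 p q (x i) (\<mu> (y i) (x k)) (y k))
      + (\<Sum>i\<in>I. \<Sum>k\<in>I. E2 p q (x i) (\<nu> (x k) (y i)) (y k))"
    by (simp add: F_def op_tens T_add sum.distrib contractions sum_subtractf)
qed

end

section \<open>Skew-symmetry and the Poisson Yang-Baxter equation\<close>

context
  fixes sAA :: "'k \<Rightarrow> 'aa::ab_group_add \<Rightarrow> 'aa" and sAAA :: "'k \<Rightarrow> 'aaa::ab_group_add \<Rightarrow> 'aaa"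
    and tAA tAAA r
  assumes r: "symmetric_tensor sA sAA tAA r I x y" and AAA: "tensor_product sAA sA sAAA tAAA"
begin

interpretation R: symmetric_tensor sA sAA tAA r I x y by (rule r)

text \<open>The flip exchanges the legs in \<open>A\<close> and in \<open>B\<close>:
  \<open>casimir_swap\<close> restores those of \<open>B\<close> with a sign, and the symmetry of
  \<open>r\<close> restores those of \<open>A\<close> without one.\<close>

lemma r_hat_skew_symmetric: "completed_skew_symmetric sPP tPP rh"
  unfolding completed_skew_symmetric_def completed_flip_def
proof (intro allI)
  fix p q
  have flip: "bilinear_map sP sP sPP (\<lambda>u v. tPP v u)"
    using PP.bilinear_tens by (simp add: bilinear_map_alt)
  show "tensor_flip sPP tPP (rh q p) = - rh p q"
  proof (cases "p + q + m = 0")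
    case True
    then have q: "q = - m - p" by simp
    have "tensor_flip sPP tPP (rh q p) =
        (\<Sum>z\<in>I \<times> B.J q. tPP (tP (y (fst z)) (f (snd z))) (tP (x (fst z)) (e (snd z))))"
      using True by (simp add: r_hat_eq tensor_flip_def PP.tensor_lift_sum[OF flip] ac_simps)
    also have "\<dots> = (\<Sum>i\<in>I. \<Sum>j\<in>B.J (- m - p). tPP (tP (y i) (f j)) (tP (x i) (e j)))"
      by (simp add: q sum.cartesian_product case_prod_unfold)
    also have "\<dots> = (\<Sum>i\<in>I. - (\<Sum>j\<in>B.J p. tPP (tP (y i) (e j)) (tP (x i) (f j))))"
      by (intro sum.cong refl B.casimir_swap[where sW = sPP and g = "\<lambda>u v. tPP (tP (y i) v) (tP (x i) u)" for i])
        (use P.bilinear_tens PP.bilinear_tens in \<open>simp add: bilinear_map_alt\<close>)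
    also have "\<dots> = - (\<Sum>j\<in>B.J p. \<Sum>i\<in>I. tPP (tP (y i) (e j)) (tP (x i) (f j)))"
      by (simp add: sum_negf) (rule sum.swap)
    also have "\<dots> = - (\<Sum>j\<in>B.J p. \<Sum>i\<in>I. tPP (tP (x i) (e j)) (tP (y i) (f j)))"
      by (intro arg_cong[of _ _ uminus] sum.cong[OF refl]
          R.sum_swap[where sW = sPP and g = "\<lambda>u v. tPP (tP u (e j)) (tP v (f j))" for j])
        (use P.bilinear_tens PP.bilinear_tens in \<open>simp add: bilinear_map_alt\<close>)
    also have "\<dots> = - (\<Sum>i\<in>I. \<Sum>j\<in>B.J p. tPP (tP (x i) (e j)) (tP (y i) (f j)))"
      by (subst sum.swap) simp
    also have "\<dots> = - rh p q"
      using True by (simp add: r_hat_eq sum.cartesian_product case_prod_unfold)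
    finally show ?thesis .
  next
    case False
    then have "q + p + m \<noteq> 0" by (simp add: add.commute)
    then show ?thesis
      using False bilinear_map_zero(1)[OF flip] PP.tensor_lift_sum[OF flip, of "\<lambda>_. 0" "\<lambda>_. 0" "{}"]
      by (simp add: r_hat_eq tensor_flip_def)
  qed
qed

text \<open>The equation for \<open>zin\<close> is paired with \<open>E1\<close>, and with
  \<open>E2\<close> after exchange of its last two arguments. This eliminates the sums with the
  product in the first slot, and the remaining ones cancel.\<close>

lemma pybe_A_r_hat:
  assumes zin: "bilinear_map sA sA sA zin" and Z: "ppybe_Z sAA sAAA tAA tAAA zin r = 0"
  shows "pybe_A sPP sPPP tPP tPPP (induced_mult sP tP zin perm) rh"
proof -
  have op: "induced_mult sP tP zin perm = op zin zin"
    by (simp add: induced_mult_def op_def[OF zin zin])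
  let ?S = "\<lambda>d F. completed_sum sPP sPPP tPP d F rh"
  have sum: "?S (\<lambda>i j k l. (i + k, j, l)) (\<lambda>x y x' y'. T (induced_mult sP tP zin perm x x') y y') n
    + ?S (\<lambda>i j k l. (i, k, j + l)) (\<lambda>x y x' y'. T x x' (induced_mult sP tP zin perm y y')) n
    - ?S (\<lambda>i j k l. (k, i + l, j)) (\<lambda>x y x' y'. T x' (induced_mult sP tP zin perm x y') y) n = 0" for n
  proof (cases n)
    case (fields a b c)
    show ?thesis
    proof (cases "a + b + c + 2 * m = 0")
      case True
      \<comment> \<open>These are the degrees of the \<open>e\<close> entries whose partners have
        degrees \<open>b\<close> and \<open>c\<close>; the condition on the total degree makes
        \<open>a\<close> equal to \<open>p + q\<close>.\<close>
      define p q where pq: "p = - m - b" "q = - m - c"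
      have n: "n = (p + q, - m - p, - m - q)" using True by (simp add: fields pq)
      have e1: "(\<Sum>i\<in>I. \<Sum>k\<in>I. E1 p q (zin (x i) (x k)) (y i) (y k)) =
          (\<Sum>i\<in>I. \<Sum>k\<in>I. E1 p q (y i) (y k) (zin (x i) (x k)))
          + (\<Sum>i\<in>I. \<Sum>k\<in>I. E1 p q (y i) (y k) (zin (x k) (x i)))
          - (\<Sum>i\<in>I. \<Sum>k\<in>I. E1 p q (y i) (zin (x i) (x k)) (y k))"
        using R.ppybe_cube_sums(1)[OF zin trilinear_E(1) AAA Z, of p q] by (simp add: algebra_simps)
      \<comment> \<open>Renaming the indices puts the arguments of \<open>E2\<close> in the order
        produced by exchanging its last two slots.\<close>
      have "(\<Sum>i\<in>I. \<Sum>k\<in>I. E2 p q (zin (x k) (x i)) (y i) (y k)) =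
          (\<Sum>i\<in>I. \<Sum>k\<in>I. E2 p q (zin (x i) (x k)) (y k) (y i))" by (rule sum.swap)
      then have e2: "(\<Sum>i\<in>I. \<Sum>k\<in>I. E2 p q (zin (x k) (x i)) (y i) (y k)) =
          (\<Sum>i\<in>I. \<Sum>k\<in>I. E2 p q (y i) (zin (x i) (x k)) (y k))
          + (\<Sum>i\<in>I. \<Sum>k\<in>I. E2 p q (y i) (zin (x k) (x i)) (y k))
          - (\<Sum>i\<in>I. \<Sum>k\<in>I. E2 p q (y i) (y k) (zin (x i) (x k)))"
        using R.ppybe_cube_sums(1)[OF zin trilinear_map_swap23[OF trilinear_E(2)] AAA Z, of p q]
        by (simp add: algebra_simps)
      show ?thesis
        unfolding n op r12_r13(2)[OF zin zin] r13_r23(2)[OF zin zin] r23_r12(2)[OF zin zin]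
          R.sums_normal_form[OF zin trilinear_E(1)] R.sums_normal_form[OF zin trilinear_E(2)] e1 e2
        by simp
    next
      case False
      then show ?thesis
        unfolding fields op by (simp add: r12_r13(3)[OF zin zin] r13_r23(3)[OF zin zin] r23_r12(3)[OF zin zin])
    qed
  qed
  show ?thesis
    unfolding pybe_A_def Let_def T_def[symmetric]
    using sum r12_r13(1)[OF zin zin, folded op] r13_r23(1)[OF zin zin, folded op] r23_r12(1)[OF zin zin, folded op]
    by blast
qed

text \<open>The elimination is that of the product, now with the equation for \<open>pre\<close>;
  the sign in \<nu> is pulled out of \<open>E1\<close> and \<open>E2\<close> by
  trilinearity.\<close>

lemma pybe_C_r_hat:
  assumes pre: "bilinear_map sA sA sA pre" and PL: "ppybe_PL sAA sAAA tAA tAAA pre r = 0"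
  shows "pybe_C sPP sPPP tPP tPPP (induced_bracket sP tP pre perm) rh"
proof -
  let ?npre = "\<lambda>u v. - pre u v"
  have npre: "bilinear_map sA sA sA ?npre" using pre by (simp add: bilinear_map_alt P.U.scale_minus_right)
  have op: "induced_bracket sP tP pre perm = op pre ?npre"
    by (simp add: induced_bracket_def op_def[OF pre npre] bilinear_map_minus[OF P.bilinear_tens])
  have E_minus: "E1 p q (- u) v w = - E1 p q u v w" "E1 p q u (- v) w = - E1 p q u v w"
      "E1 p q u v (- w) = - E1 p q u v w"
      "E2 p q (- u) v w = - E2 p q u v w" "E2 p q u (- v) w = - E2 p q u v w"
      "E2 p q u v (- w) = - E2 p q u v w" for p q u v w
    using trilinear_E[of p q] unfolding trilinear_map_def by (blast dest: bilinear_map_minus)+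
  let ?S = "\<lambda>d F. completed_sum sPP sPPP tPP d F rh"
  have sum: "?S (\<lambda>i j k l. (i + k, j, l)) (\<lambda>x y x' y'. T (induced_bracket sP tP pre perm x x') y y') n
    + ?S (\<lambda>i j k l. (i, k, j + l)) (\<lambda>x y x' y'. T x x' (induced_bracket sP tP pre perm y y')) n
    + ?S (\<lambda>i j k l. (i, j + k, l)) (\<lambda>x y x' y'. T x (induced_bracket sP tP pre perm y x') y') n = 0" for n
  proof (cases n)
    case (fields a b c)
    show ?thesis
    proof (cases "a + b + c + 2 * m = 0")
      case True
      define p q where pq: "p = - m - b" "q = - m - c"
      have n: "n = (p + q, - m - p, - m - q)" using True by (simp add: fields pq)
      have e1: "(\<Sum>i\<in>I. \<Sum>k\<in>I. E1 p q (pre (x i) (x k)) (y i) (y k)) =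
          (\<Sum>i\<in>I. \<Sum>k\<in>I. E1 p q (y i) (pre (x i) (x k)) (y k))
          + (\<Sum>i\<in>I. \<Sum>k\<in>I. E1 p q (y i) (y k) (pre (x i) (x k)))
          - (\<Sum>i\<in>I. \<Sum>k\<in>I. E1 p q (y i) (y k) (pre (x k) (x i)))"
        using R.ppybe_cube_sums(2)[OF pre trilinear_E(1) AAA PL, of p q] by (simp add: algebra_simps)
      have "(\<Sum>i\<in>I. \<Sum>k\<in>I. E2 p q (pre (x k) (x i)) (y i) (y k)) =
          (\<Sum>i\<in>I. \<Sum>k\<in>I. E2 p q (pre (x i) (x k)) (y k) (y i))" by (rule sum.swap)
      then have e2: "(\<Sum>i\<in>I. \<Sum>k\<in>I. E2 p q (pre (x k) (x i)) (y i) (y k)) =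
          (\<Sum>i\<in>I. \<Sum>k\<in>I. E2 p q (y i) (y k) (pre (x i) (x k)))
          + (\<Sum>i\<in>I. \<Sum>k\<in>I. E2 p q (y i) (pre (x i) (x k)) (y k))
          - (\<Sum>i\<in>I. \<Sum>k\<in>I. E2 p q (y i) (pre (x k) (x i)) (y k))"
        using R.ppybe_cube_sums(2)[OF pre trilinear_map_swap23[OF trilinear_E(2)] AAA PL, of p q]
        by (simp add: algebra_simps)
      show ?thesis
        unfolding n op r12_r13(2)[OF pre npre] r13_r23(2)[OF pre npre] r12_r23(2)[OF pre npre] E_minus sum_negf
          R.sums_normal_form[OF pre trilinear_E(1)] R.sums_normal_form[OF pre trilinear_E(2)] e1 e2
        by simp
    next
      case False
      then show ?thesis
        unfolding fields op by (simp add: r12_r13(3)[OF pre npre] r13_r23(3)[OF pre npre] r12_r23(3)[OF pre npre])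
    qed
  qed
  show ?thesis
    unfolding pybe_C_def Let_def T_def[symmetric]
    using sum r12_r13(1)[OF pre npre, folded op] r13_r23(1)[OF pre npre, folded op] r12_r23(1)[OF pre npre, folded op]
    by blast
qed

end

end

theorem proposition4p16:
  fixes sA :: "'k::field_char_0 \<Rightarrow> 'a::ab_group_add \<Rightarrow> 'a"
    and sB :: "'k \<Rightarrow> 'b::ab_group_add \<Rightarrow> 'b"
    and sAA :: "'k \<Rightarrow> 'aa::ab_group_add \<Rightarrow> 'aa"
    and sAAA :: "'k \<Rightarrow> 'aaa::ab_group_add \<Rightarrow> 'aaa"
    and sP :: "'k \<Rightarrow> 'p::ab_group_add \<Rightarrow> 'p"
    and sPP :: "'k \<Rightarrow> 'pp::ab_group_add \<Rightarrow> 'pp"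
    and sPPP :: "'k \<Rightarrow> 'ppp::ab_group_add \<Rightarrow> 'ppp"
    and tAA :: "'a \<Rightarrow> 'a \<Rightarrow> 'aa" and tAAA :: "'aa \<Rightarrow> 'a \<Rightarrow> 'aaa"
    and tP :: "'a \<Rightarrow> 'b \<Rightarrow> 'p"
    and tPP :: "'p \<Rightarrow> 'p \<Rightarrow> 'pp" and tPPP :: "'pp \<Rightarrow> 'p \<Rightarrow> 'ppp"
    and zin pre :: "'a \<Rightarrow> 'a \<Rightarrow> 'a"
    and perm :: "'b \<Rightarrow> 'b \<Rightarrow> 'b" and G :: "int \<Rightarrow> 'b set" and \<omega> :: "'b \<Rightarrow> 'b \<Rightarrow> 'k"
    and r :: 'aa and I :: "'i set" and x y :: "'i \<Rightarrow> 'a"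
    and \<Omega> :: "'j set" and e f :: "'j \<Rightarrow> 'b"
  assumes pre_poisson: "pre_poisson_algebra sA zin pre"
    and finite_dim: "finite_dim_subspace sA UNIV"
    and perm: "quadratic_graded_perm_algebra sB perm G \<omega>"
    and AA: "tensor_product sA sA sAA tAA"
    and AAA: "tensor_product sAA sA sAAA tAAA"
    and P: "tensor_product sA sB sP tP"
    and PP: "tensor_product sP sP sPP tPP"
    and PPP: "tensor_product sPP sP sPPP tPPP"
    and r: "finite I" "r = (\<Sum>i\<in>I. tAA (x i) (y i))"
    and symmetric: "tensor_flip sAA tAA r = r"
    and ppybe: "ppybe_solution sAA sAAA tAA tAAA zin pre r"
    and e: "homogeneous_basis sB G \<Omega> e"
    and f: "homogeneous_basis sB G \<Omega> f"
    and dual: "\<forall>i\<in>\<Omega>. \<forall>j\<in>\<Omega>. \<omega> (f i) (e j) = (if i = j then 1 else 0)"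
  shows "completed_skew_symmetric sPP tPP (r_hat tPP tP G I x y \<Omega> e f) \<and>
         completed_pybe_solution sPP sPPP tPP tPPP (induced_grading sP tP G)
           (induced_mult sP tP zin perm) (induced_bracket sP tP pre perm)
           (r_hat tPP tP G I x y \<Omega> e f)"
proof -
  interpret A: pre_poisson_algebra sA zin pre by fact
  interpret B: quadratic_graded_perm_algebra sB perm G \<omega> by fact
  interpret AA: tensor_product sA sA sAA tAA by fact
  interpret P: tensor_product sA sB sP tP by fact
  interpret PP: tensor_product sP sP sPP tPP by fact
  interpret PPP: tensor_product sPP sP sPPP tPPP by fact
  \<comment> \<open>The axioms assert only that a shift exists, while \<open>induced_tensor\<close>
    takes it as a parameter.\<close>
  obtain m where m: "\<forall>i j. i + j + m \<noteq> 0 \<longrightarrow> (\<forall>b1\<in>G i. \<forall>b2\<in>G j. \<omega> b1 b2 = 0)"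
    using B.graded_form by blast
  interpret induced_tensor sA sB sP sPP sPPP perm G \<omega> m \<Omega> e f tP tPP tPPP I x y
    by unfold_locales (use m e f dual in auto)
  have r': "symmetric_tensor sA sAA tAA r I x y"
    by unfold_locales (use r symmetric in auto)
  have "ppybe_Z sAA sAAA tAA tAAA zin r = 0" "ppybe_PL sAA sAAA tAA tAAA pre r = 0"
    using ppybe by (simp_all add: ppybe_solution_def)
  with pybe_A_r_hat[OF r' AAA A.bilinear_zin] pybe_C_r_hat[OF r' AAA A.bilinear_pre] show ?thesis
    unfolding completed_pybe_solution_def
    using r_hat_skew_symmetric[OF r' AAA] r_hat_in_completed by blast
qed

end
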